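(* Suppose $K_i=K$ and $L_i=L$ for all $i\in\mathcal V$. The decentralized SVR-PD algorithm (described in the context), run with constant step size $\eta_i=\eta=\frac1{6L}$ for all $i$ and epoch lengths $m_{s+1}=2^sm_1$, incurs an oracle complexity of $$O\left(\frac{E+VL}{\epsilon}+K\log\Big(\frac{E+VL}{\epsilon}\Big)\right),$$ and its communication complexity is $O\big(\frac{E+VL}{\epsilon}\big)$.
   Context: $\mathcal G=(\mathcal V,\mathcal E)$ is a connected undirected graph with $V=|\mathcal V|$ nodes and $E=|\mathcal E|$ edges; $\mathcal N_i$ is the set of neighbors of $i$. For each node $i$, $f_i(\mathbf{x})=\frac1{K_i}\sum_{k=1}^{K_i} f_i(\mathbf{x},\xi_i^k)$ on $\mathbb R^n$ with each $f_i(\cdot,\xi_i^k)$ proper, closed, convex and $L_i$-smooth; each $h_i$ is proper, closed, convex, possibly non-smooth. $\mathbf{x}_i^\star$ ($i\in\mathcal V$) is a solution of $\min\sum_{i\in\mathcal V}(f_i(\mathbf{x}_i)+h_i(\mathbf{x}_i))$ s.t. $\mathbf{x}_i=\mathbf{x}_j$ for all $(i,j)\in\mathcal E$, and $\boldsymbol\lambda_{ij}^\star$ (one for each ordered pair of neighbors), $\mathbf{v}_i^\star\in\partial h_i(\mathbf{x}_i^\star)$ satisfy $\mathbf{x}_i^\star=\mathbf{x}_j^\star$ $(=:\mathbf{x}^\star)$, $\boldsymbol\lambda_{ij}^\star+\boldsymbol\lambda_{ji}^\star=0$, $\mathbf{v}_i^\star+\nabla f_i(\mathbf{x}_i^\star)+\sum_{j\in\mathcal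 N_i}\boldsymbol\lambda_{ji}^\star=0$. Bregman divergences: $D_{f_i}(\mathbf{x},\mathbf{y})=f_i(\mathbf{x})-f_i(\mathbf{y})-\langle\nabla f_i(\mathbf{y}),\mathbf{x}-\mathbf{y}\rangle$; $D_{h_i}(\mathbf{x},\mathbf{x}_i^\star)=h_i(\mathbf{x})-h_i(\mathbf{x}_i^\star)-\langle\mathbf{v}_i^\star,\mathbf{x}-\mathbf{x}_i^\star\rangle$; $D_{f_i+h_i}=D_{f_i}+D_{h_i}$. Decentralized SVR-PD: given $\rho>0$, $\eta_i>0$ and epoch lengths $m_s$, initialize $\tilde{\mathbf{x}}_i^1=\mathbf{x}_i^0$ and $\boldsymbol\lambda_{ij}^0$. For epochs $s=1,2,\dots,S$: for $t=0,1,\dots,m_s-1$, at each node $i$ pick $k_i^t\in\{1,\dots,K_i\}$ uniformly at random, set $$\mathbf{g}_i^t=\nabla f_i(\mathbf{x}_i^t,\xi_i^{k_i^t})-\nabla f_i(\tilde{\mathbf{x}}_i^s,\xi_i^{k_i^t})+\nabla f_i(\tilde{\mathbf{x}}_i^s),$$ and for all $i\in\mathcal V$, $j\in\mathcal N_i$ update $$\mathbf{x}_i^{t+1}=\mathrm{prox}_{\gamma_ih_i}\Big(\tfrac{\gamma_i}{\eta_i}[\mathbf{x}_i^t-\eta_i\mathbf{g}_i^t]+\gamma_i\sum_{j\in\mathcal N_i}[\rho\mathbf{x}_j^t-\boldsymbol\lambda_{ji}^t]\Big),\qquad \boldsymbol\lambda_{ij}^{t+1}=-\boldsymbol\lambda_{ji}^t+\rho(\mathbf{x}_j^t-\mathbf{x}_i^{t+1}),$$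 with $\gamma_i=(\frac1{\eta_i}+\rho|\mathcal N_i|)^{-1}$ and $\mathrm{prox}_{\eta h}(\mathbf{y})=\arg\min_{\mathbf{x}}h(\mathbf{x})+\frac1{2\eta}\|\mathbf{y}-\mathbf{x}\|^2$. At the end of epoch $s$, set $\tilde{\mathbf{x}}_i^{s+1}=\frac1{m_s}\sum_{t=1}^{m_s}\mathbf{x}_i^t$, and start the next epoch from $\mathbf{x}_i^0:=\mathbf{x}_i^{m_s}$, $\boldsymbol\lambda_{ij}^0:=\boldsymbol\lambda_{ij}^{m_s}$. The full gradients $\nabla f_i(\tilde{\mathbf{x}}_i^s)$ are computed once per epoch. Conventions. The oracle complexity is the number of oracle calls, i.e. evaluations of $\{\nabla f_i(\cdot,\xi_i^k)\}_{i\in\mathcal V}$ (one component gradient at every node; a full gradient costs $K$ calls), required for the cumulative Bregman divergence of the output, $\sum_{i\in\mathcal V}\mathbb E[D_{f_i+h_i}(\tilde{\mathbf{x}}_i^{S+1},\mathbf{x}_i^\star)]$, to be at most $\epsilon$. The communication complexity is the total number of network-wide communication rounds over the same horizon (one round per inner iteration, in which neighbors exchange primal and dual variables). $W_1$ is a constant bounding, at the initial point, $\max_{i,j}\{\|\mathbf{x}_i-\mathbf{x}_i^\star\|^2,\|\boldsymbol\lambda_{ij}-\boldsymbol\lambda_{ij}^\star\|^2,D_{f_i+h_i}(\mathbf{x}_i,\mathbf{x}_i^\star)\}$. The $O(\cdot)$ notation subsumes universal constants and initialization-dependent constants such as $W_1$ and $m_1$; $\rho$ is a fixed constant, so that $2E(\rho+1/\rho)+2V=O(E)$.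 *)

theory Defs
  imports "HOL-Probability.Probability"
begin

section \<open>Euclidean spaces of varying dimension\<close>

text \<open>
  The constants hidden in \<open>O(\<dots>)\<close> must not depend on the dimension of the ambient space. HOL
  cannot quantify over types below an existential quantifier, so a statement over
  \<^typ>\<open>real ^ 'n\<close> would let these constants depend on the dimension. Therefore all the spaces
  \<open>\<real>\<^sup>n\<close> live inside one inner product type, the finitely supported real sequences;
  \<open>\<real>\<^sup>n\<close> consists of the sequences that vanish from index \<open>n\<close> on.
\<close>

typedef fvec = "{x :: nat \<Rightarrow> real. finite {k. x k \<noteq> 0}}"
  morphisms coord Abs_fvec
  by (rule exI [where x = "\<lambda>_. 0"]) simp

setup_lifting type_definition_fvec

instantiation fvec :: ab_group_add
begin

lift_definition zero_fvec :: fvec is "\<lambda>_. 0"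
  by simp

lift_definition plus_fvec :: "fvec \<Rightarrow> fvec \<Rightarrow> fvec" is "\<lambda>x y k. x k + y k"
proof -
  fix x y :: "nat \<Rightarrow> real"
  assume "finite {k. x k \<noteq> 0}" "finite {k. y k \<noteq> 0}"
  then show "finite {k. x k + y k \<noteq> 0}"
    by (rule finite_subset [rotated, OF finite_UnI]) auto
qed

lift_definition minus_fvec :: "fvec \<Rightarrow> fvec \<Rightarrow> fvec" is "\<lambda>x y k. x k - y k"
proof -
  fix x y :: "nat \<Rightarrow> real"
  assume "finite {k. x k \<noteq> 0}" "finite {k. y k \<noteq> 0}"
  then show "finite {k. x k - y k \<noteq> 0}"
    by (rule finite_subset [rotated, OF finite_UnI]) auto
qed

lift_definition uminus_fvec :: "fvec \<Rightarrow> fvec" is "\<lambda>x k. - x k"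
  by simp

instance
  by standard (transfer; auto)+

end

lemma finite_coord_support [simp]: "finite {k. coord x k \<noteq> 0}"
  using coord [of x] by simp

lemma fvec_eq_iff: "x = y \<longleftrightarrow> (\<forall>k. coord x k = coord y k)"
  by (metis coord_inject ext)

lemma coord_zero [simp]: "coord 0 k = 0"
  and coord_add [simp]: "coord (x + y) k = coord x k + coord y k"
  and coord_diff [simp]: "coord (x - y) k = coord x k - coord y k"
  and coord_minus [simp]: "coord (- x) k = - coord x k"
  by (transfer; simp)+

instantiation fvec :: real_vector
begin

lift_definition scaleR_fvec :: "real \<Rightarrow> fvec \<Rightarrow> fvec" is "\<lambda>r x k. r * x k"
  by (rule finite_subset [rotated]) auto

lemma coord_scaleR [simp]: "coord (r *\<^sub>R x) k = r * coord x k"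
  by transfer simp

instance
  by standard (auto simp: fvec_eq_iff algebra_simps)

end

instantiation fvec :: real_inner
begin

definition inner_fvec :: "fvec \<Rightarrow> fvec \<Rightarrow> real" where
  "inner_fvec x y = (\<Sum>k | coord x k * coord y k \<noteq> 0. coord x k * coord y k)"

definition norm_fvec :: "fvec \<Rightarrow> real" where
  "norm_fvec x = sqrt (inner x x)"

definition dist_fvec :: "fvec \<Rightarrow> fvec \<Rightarrow> real" where
  "dist_fvec x y = norm (x - y)"

definition sgn_fvec :: "fvec \<Rightarrow> fvec" where
  "sgn_fvec x = x /\<^sub>R norm x"

definition uniformity_fvec :: "(fvec \<times> fvec) filter" where
  "uniformity_fvec = (INF e\<in>{0 <..}. principal {(x, y). dist x y < e})"

definition open_fvec :: "fvec set \<Rightarrow> bool" where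
  "open_fvec U \<longleftrightarrow> (\<forall>x\<in>U. eventually (\<lambda>(x', y). x' = x \<longrightarrow> y \<in> U) uniformity)"

lemma inner_fvec_eq_sum:
  assumes "finite A" "{k. coord x k \<noteq> 0} \<subseteq> A \<or> {k. coord y k \<noteq> 0} \<subseteq> A"
  shows "inner x y = (\<Sum>k\<in>A. coord x k * coord y k)"
  unfolding inner_fvec_def using assms by (intro sum.mono_neutral_left) auto

instance
proof
  fix x y z :: fvec and r :: real and U :: "fvec set"
  let ?A = "{k. coord x k \<noteq> 0} \<union> {k. coord y k \<noteq> 0} \<union> {k. coord z k \<noteq> 0}"
  have fin: "finite ?A" by simp
  show "dist x y = norm (x - y)" by (rule dist_fvec_def)
  show "sgn x = x /\<^sub>R norm x" by (rule sgn_fvec_def)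
  show "(uniformity :: (fvec \<times> fvec) filter)
      = (INF e\<in>{0 <..}. principal {(x, y). dist x y < e})"
    by (rule uniformity_fvec_def)
  show "open U \<longleftrightarrow> (\<forall>x\<in>U. \<forall>\<^sub>F (x', y) in uniformity. x' = x \<longrightarrow> y \<in> U)"
    by (rule open_fvec_def)
  show "inner x y = inner y x" by (simp add: inner_fvec_def mult.commute)
  show "inner (x + y) z = inner x z + inner y z"
    using fin by (subst (1 2 3) inner_fvec_eq_sum [where A = ?A])
      (auto simp: algebra_simps sum.distrib)
  show "inner (r *\<^sub>R x) y = r * inner x y"
    using fin by (subst (1 2) inner_fvec_eq_sum [where A = ?A])
      (auto simp: sum_distrib_left algebra_simps)
  show "0 \<le> inner x x" by (simp add: inner_fvec_def sum_nonneg)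
  show "inner x x = 0 \<longleftrightarrow> x = 0"
    by (subst inner_fvec_eq_sum [where A = "{k. coord x k \<noteq> 0}"])
      (auto simp: sum_nonneg_eq_0_iff fvec_eq_iff)
  show "norm x = sqrt (inner x x)" by (rule norm_fvec_def)
qed

end

definition Rn :: "nat \<Rightarrow> fvec set" where
  "Rn n = {x. \<forall>k\<ge>n. coord x k = 0}"

section \<open>Convex analysis\<close>

definition grad :: "nat \<Rightarrow> (fvec \<Rightarrow> real) \<Rightarrow> fvec \<Rightarrow> fvec" where
  "grad n f x = (THE g. g \<in> Rn n \<and> (f has_derivative (\<lambda>y. g \<bullet> y)) (at x within Rn n))"

definition smooth_on_Rn :: "nat \<Rightarrow> real \<Rightarrow> (fvec \<Rightarrow> real) \<Rightarrow> bool" where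
  "smooth_on_Rn n L f \<longleftrightarrow> f differentiable_on Rn n \<and> L-lipschitz_on (Rn n) (grad n f)"

definition epigraph :: "nat \<Rightarrow> (fvec \<Rightarrow> ereal) \<Rightarrow> (fvec \<times> real) set" where
  "epigraph n h = {(x, r). x \<in> Rn n \<and> h x \<le> ereal r}"

definition proper_closed_convex :: "nat \<Rightarrow> (fvec \<Rightarrow> ereal) \<Rightarrow> bool" where
  "proper_closed_convex n h \<longleftrightarrow>
     (\<forall>x\<in>Rn n. h x \<noteq> - \<infinity>) \<and> (\<exists>x\<in>Rn n. h x \<noteq> \<infinity>) \<and>
     closed (epigraph n h) \<and> convex (epigraph n h)"

definition subdifferential :: "nat \<Rightarrow> (fvec \<Rightarrow> ereal) \<Rightarrow> fvec \<Rightarrow> fvec set" where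
  "subdifferential n h x =
     {v \<in> Rn n. \<bar>h x\<bar> \<noteq> \<infinity> \<and> (\<forall>y\<in>Rn n. h y \<ge> h x + ereal (v \<bullet> (y - x)))}"

text \<open>\<open>prox n \<gamma> h\<close> is the proximal operator of \<open>\<gamma> h\<close>.\<close>

definition prox :: "nat \<Rightarrow> real \<Rightarrow> (fvec \<Rightarrow> ereal) \<Rightarrow> fvec \<Rightarrow> fvec" where
  "prox n \<gamma> h y = arg_min_on (\<lambda>x. h x + ereal ((norm (y - x))\<^sup>2 / (2 * \<gamma>))) (Rn n)"

definition bregman :: "nat \<Rightarrow> (fvec \<Rightarrow> real) \<Rightarrow> fvec \<Rightarrow> fvec \<Rightarrow> real" where
  "bregman n f x y = f x - f y - grad n f y \<bullet> (x - y)"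

definition bregman_sub :: "(fvec \<Rightarrow> ereal) \<Rightarrow> fvec \<Rightarrow> fvec \<Rightarrow> fvec \<Rightarrow> ereal" where
  "bregman_sub h v x y = h x - h y - ereal (v \<bullet> (x - y))"

section \<open>The decentralized problem\<close>

definition connected_graph :: "nat set \<Rightarrow> nat set set \<Rightarrow> bool" where
  "connected_graph V E \<longleftrightarrow>
     finite V \<and> V \<noteq> {} \<and> (\<forall>e\<in>E. e \<subseteq> V \<and> card e = 2) \<and>
     (\<forall>i\<in>V. \<forall>j\<in>V. (i, j) \<in> {(a, b). {a, b} \<in> E}\<^sup>*)"

text \<open>
  \<open>component P i k\<close> is \<open>f\<^sub>i(\<cdot>, \<xi>\<^sub>i\<^sup>k)\<close> for \<open>1 \<le> k \<le> ncomp P i\<close>, and \<open>smoothness P i\<close> is its smoothness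
  constant \<open>L\<^sub>i\<close>. Values outside \<open>Rn (space_dim P)\<close> and at indices outside \<open>nodes P\<close> are irrelevant.
\<close>

record decentralized_problem =
  space_dim :: nat
  nodes :: "nat set"
  edges :: "nat set set"
  ncomp :: "nat \<Rightarrow> nat"
  smoothness :: "nat \<Rightarrow> real"
  component :: "nat \<Rightarrow> nat \<Rightarrow> fvec \<Rightarrow> real"
  reg :: "nat \<Rightarrow> fvec \<Rightarrow> ereal"

definition nbrs :: "decentralized_problem \<Rightarrow> nat \<Rightarrow> nat set" where
  "nbrs P i = {j. {i, j} \<in> edges P}"

definition loss :: "decentralized_problem \<Rightarrow> nat \<Rightarrow> fvec \<Rightarrow> real" where
  "loss P i x = (\<Sum>k = 1..ncomp P i. component P i k x) / real (ncomp P i)"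

text \<open>
  A real-valued function that is differentiable on \<open>\<real>\<^sup>n\<close> is automatically proper and closed, so
  only convexity and smoothness are required of the components.
\<close>

definition valid_problem :: "decentralized_problem \<Rightarrow> bool" where
  "valid_problem P \<longleftrightarrow>
     connected_graph (nodes P) (edges P) \<and>
     (\<forall>i\<in>nodes P.
        ncomp P i \<ge> 1 \<and> smoothness P i > 0 \<and>
        (\<forall>k\<in>{1..ncomp P i}.
           convex_on (Rn (space_dim P)) (component P i k) \<and>
           smooth_on_Rn (space_dim P) (smoothness P i) (component P i k)) \<and>
        proper_closed_convex (space_dim P) (reg P i))"

definition feasible :: "decentralized_problem \<Rightarrow> (nat \<Rightarrow> fvec) \<Rightarrow> bool" where
  "feasible P x \<longleftrightarrow>
     (\<forall>i\<in>nodes P. x i \<in> Rn (space_dim P)) \<and> (\<forall>i\<in>nodes P. \<forall>j\<in>nbrs P i. x i = x j)"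

definition objective :: "decentralized_problem \<Rightarrow> (nat \<Rightarrow> fvec) \<Rightarrow> ereal" where
  "objective P x = (\<Sum>i\<in>nodes P. ereal (loss P i (x i)) + reg P i (x i))"

definition optimal_triple ::
  "decentralized_problem \<Rightarrow> (nat \<Rightarrow> fvec) \<Rightarrow> (nat \<Rightarrow> nat \<Rightarrow> fvec) \<Rightarrow> (nat \<Rightarrow> fvec) \<Rightarrow> bool" where
  "optimal_triple P xs ls vs \<longleftrightarrow>
     is_arg_min (objective P) (feasible P) xs \<and>
     (\<forall>i\<in>nodes P.
        vs i \<in> subdifferential (space_dim P) (reg P i) (xs i) \<and>
        (\<forall>j\<in>nbrs P i. ls i j \<in> Rn (space_dim P) \<and> ls i j + ls j i = 0) \<and>
        vs i + grad (space_dim P) (loss P i) (xs i) + (\<Sum>j\<in>nbrs P i. ls j i) = 0)"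

text \<open>\<open>D\<close> of \<open>f\<^sub>i + h\<^sub>i\<close> at \<open>x\<close> relative to the reference point \<open>y\<close> with subgradient \<open>v\<close> of \<open>h\<^sub>i\<close>.\<close>

definition bregman_total ::
  "decentralized_problem \<Rightarrow> nat \<Rightarrow> fvec \<Rightarrow> fvec \<Rightarrow> fvec \<Rightarrow> ereal" where
  "bregman_total P i v x y =
     ereal (bregman (space_dim P) (loss P i) x y) + bregman_sub (reg P i) v x y"

definition initial_bound ::
  "decentralized_problem \<Rightarrow> (nat \<Rightarrow> fvec) \<Rightarrow> (nat \<Rightarrow> nat \<Rightarrow> fvec) \<Rightarrow> (nat \<Rightarrow> fvec) \<Rightarrow>
   (nat \<Rightarrow> fvec) \<Rightarrow> (nat \<Rightarrow> nat \<Rightarrow> fvec) \<Rightarrow> real \<Rightarrow> bool" where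
  "initial_bound P xs ls vs x0 l0 W \<longleftrightarrow>
     (\<forall>i\<in>nodes P.
        x0 i \<in> Rn (space_dim P) \<and> (norm (x0 i - xs i))\<^sup>2 \<le> W \<and>
        bregman_total P i (vs i) (x0 i) (xs i) \<le> ereal W \<and>
        (\<forall>j\<in>nbrs P i. l0 i j \<in> Rn (space_dim P) \<and> (norm (l0 i j - ls i j))\<^sup>2 \<le> W))"

section \<open>Decentralized SVR-PD\<close>

text \<open>\<open>y i\<close> is the snapshot at node \<open>i\<close> and \<open>k\<close> the sampled component.\<close>

definition vr_gradient ::
  "decentralized_problem \<Rightarrow> (nat \<Rightarrow> fvec) \<Rightarrow> (nat \<Rightarrow> fvec) \<Rightarrow> nat \<Rightarrow> nat \<Rightarrow> fvec" where
  "vr_gradient P y x i k =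
     grad (space_dim P) (component P i k) (x i) - grad (space_dim P) (component P i k) (y i) +
     grad (space_dim P) (loss P i) (y i)"

definition primal_update ::
  "decentralized_problem \<Rightarrow> real \<Rightarrow> (nat \<Rightarrow> real) \<Rightarrow> (nat \<Rightarrow> nat) \<Rightarrow>
   (nat \<Rightarrow> fvec) \<Rightarrow> (nat \<Rightarrow> fvec) \<Rightarrow> (nat \<Rightarrow> nat \<Rightarrow> fvec) \<Rightarrow> nat \<Rightarrow> fvec" where
  "primal_update P \<rho> \<eta> k y x l i =
     (let \<gamma> = inverse (1 / \<eta> i + \<rho> * real (card (nbrs P i)))
      in prox (space_dim P) \<gamma> (reg P i)
           ((\<gamma> / \<eta> i) *\<^sub>R (x i - \<eta> i *\<^sub>R vr_gradient P y x i (k i)) +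
            \<gamma> *\<^sub>R (\<Sum>j\<in>nbrs P i. \<rho> *\<^sub>R x j - l j i)))"

definition dual_update ::
  "real \<Rightarrow> (nat \<Rightarrow> fvec) \<Rightarrow> (nat \<Rightarrow> fvec) \<Rightarrow> (nat \<Rightarrow> nat \<Rightarrow> fvec) \<Rightarrow> nat \<Rightarrow> nat \<Rightarrow> fvec" where
  "dual_update \<rho> x x' l i j = - l j i + \<rho> *\<^sub>R (x j - x' i)"

definition sample_indices :: "decentralized_problem \<Rightarrow> (nat \<Rightarrow> nat) pmf" where
  "sample_indices P = Pi_pmf (nodes P) 0 (\<lambda>i. pmf_of_set {1..ncomp P i})"

text \<open>
  The distribution of \<open>(x\<^sup>t, \<lambda>\<^sup>t, x\<^sup>1 + \<dots> + x\<^sup>t)\<close> after \<open>t\<close> inner iterations with snapshot \<open>y\<close>.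
\<close>

primrec inner_loop ::
  "decentralized_problem \<Rightarrow> real \<Rightarrow> (nat \<Rightarrow> real) \<Rightarrow> (nat \<Rightarrow> fvec) \<Rightarrow>
   (nat \<Rightarrow> fvec) \<Rightarrow> (nat \<Rightarrow> nat \<Rightarrow> fvec) \<Rightarrow> nat \<Rightarrow>
   ((nat \<Rightarrow> fvec) \<times> (nat \<Rightarrow> nat \<Rightarrow> fvec) \<times> (nat \<Rightarrow> fvec)) pmf" where
  "inner_loop P \<rho> \<eta> y x0 l0 0 = return_pmf (x0, l0, \<lambda>i. 0)"
| "inner_loop P \<rho> \<eta> y x0 l0 (Suc t) =
     do {
       (x, l, acc) \<leftarrow> inner_loop P \<rho> \<eta> y x0 l0 t;
       k \<leftarrow> sample_indices P;
       let x' = primal_update P \<rho> \<eta> k y x l;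
       return_pmf (x', dual_update \<rho> x x' l, \<lambda>i. acc i + x' i)
     }"

text \<open>
  The distribution, after epochs \<open>1, \<dots>, S\<close>, of the current \<open>x\<close>, the current \<open>\<lambda>\<close> and the snapshot
  \<open>x\<close>-tilde of epoch \<open>S + 1\<close>; \<open>m s\<close> is the length of epoch \<open>s\<close>.
\<close>

primrec svrpd ::
  "decentralized_problem \<Rightarrow> real \<Rightarrow> (nat \<Rightarrow> real) \<Rightarrow> (nat \<Rightarrow> nat) \<Rightarrow>
   (nat \<Rightarrow> fvec) \<Rightarrow> (nat \<Rightarrow> nat \<Rightarrow> fvec) \<Rightarrow> nat \<Rightarrow>
   ((nat \<Rightarrow> fvec) \<times> (nat \<Rightarrow> nat \<Rightarrow> fvec) \<times> (nat \<Rightarrow> fvec)) pmf" where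
  "svrpd P \<rho> \<eta> m x0 l0 0 = return_pmf (x0, l0, x0)"
| "svrpd P \<rho> \<eta> m x0 l0 (Suc s) =
     do {
       (x, l, y) \<leftarrow> svrpd P \<rho> \<eta> m x0 l0 s;
       (x', l', acc) \<leftarrow> inner_loop P \<rho> \<eta> y x l (m (Suc s));
       return_pmf (x', l', \<lambda>i. (1 / real (m (Suc s))) *\<^sub>R acc i)
     }"

section \<open>Complexity\<close>

text \<open>
  The expected cumulative Bregman divergence of the output of \<open>S\<close> epochs. The divergences are
  nonnegative and may be infinite (\<open>h\<^sub>i\<close> is extended-valued), whence the expectation is taken
  in \<^typ>\<open>ennreal\<close>.
\<close>

definition expected_divergence ::
  "decentralized_problem \<Rightarrow> real \<Rightarrow> (nat \<Rightarrow> real) \<Rightarrow> (nat \<Rightarrow> nat) \<Rightarrow>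
   (nat \<Rightarrow> fvec) \<Rightarrow> (nat \<Rightarrow> nat \<Rightarrow> fvec) \<Rightarrow> (nat \<Rightarrow> fvec) \<Rightarrow> (nat \<Rightarrow> fvec) \<Rightarrow> nat \<Rightarrow> ennreal" where
  "expected_divergence P \<rho> \<eta> m x0 l0 xs vs S =
     (\<Sum>i\<in>nodes P.
        \<integral>\<^sup>+ (x, l, y). e2ennreal (bregman_total P i (vs i) (y i) (xs i))
          \<partial>measure_pmf (svrpd P \<rho> \<eta> m x0 l0 S))"

definition sufficient_epochs ::
  "decentralized_problem \<Rightarrow> real \<Rightarrow> (nat \<Rightarrow> real) \<Rightarrow> (nat \<Rightarrow> nat) \<Rightarrow>
   (nat \<Rightarrow> fvec) \<Rightarrow> (nat \<Rightarrow> nat \<Rightarrow> fvec) \<Rightarrow> (nat \<Rightarrow> fvec) \<Rightarrow> (nat \<Rightarrow> fvec) \<Rightarrow> real \<Rightarrow> nat set" where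
  "sufficient_epochs P \<rho> \<eta> m x0 l0 xs vs \<epsilon> =
     {S. S \<ge> 1 \<and> expected_divergence P \<rho> \<eta> m x0 l0 xs vs S \<le> ennreal \<epsilon>}"

text \<open>
  With \<open>K\<close> components at every node, an epoch takes \<open>K\<close> oracle calls for the full gradients at the
  snapshot and two per inner iteration (at the current iterate and at the snapshot). Both
  complexities are infinite if the accuracy \<open>\<epsilon>\<close> is never reached.
\<close>

definition oracle_complexity ::
  "decentralized_problem \<Rightarrow> real \<Rightarrow> (nat \<Rightarrow> real) \<Rightarrow> (nat \<Rightarrow> nat) \<Rightarrow> nat \<Rightarrow>
   (nat \<Rightarrow> fvec) \<Rightarrow> (nat \<Rightarrow> nat \<Rightarrow> fvec) \<Rightarrow> (nat \<Rightarrow> fvec) \<Rightarrow> (nat \<Rightarrow> fvec) \<Rightarrow> real \<Rightarrow> enat" where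
  "oracle_complexity P \<rho> \<eta> m K x0 l0 xs vs \<epsilon> =
     (INF S\<in>sufficient_epochs P \<rho> \<eta> m x0 l0 xs vs \<epsilon>. enat (\<Sum>s = 1..S. K + 2 * m s))"

definition communication_complexity ::
  "decentralized_problem \<Rightarrow> real \<Rightarrow> (nat \<Rightarrow> real) \<Rightarrow> (nat \<Rightarrow> nat) \<Rightarrow>
   (nat \<Rightarrow> fvec) \<Rightarrow> (nat \<Rightarrow> nat \<Rightarrow> fvec) \<Rightarrow> (nat \<Rightarrow> fvec) \<Rightarrow> (nat \<Rightarrow> fvec) \<Rightarrow> real \<Rightarrow> enat" where
  "communication_complexity P \<rho> \<eta> m x0 l0 xs vs \<epsilon> =
     (INF S\<in>sufficient_epochs P \<rho> \<eta> m x0 l0 xs vs \<epsilon>. enat (\<Sum>s = 1..S. m s))"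

end

theory Submission
  imports Defs
begin

text \<open>
  Write \<open>u = x - x\<^sup>\<star>\<close>, \<open>a = \<lambda> - \<lambda>\<^sup>\<star>\<close> and
  \<open>\<Psi> = 3 L \<Sum>\<^sub>i \<parallel>u\<^sub>i\<parallel>\<^sup>2 + (4 \<rho>)\<^sup>-\<^sup>1 \<Sum>\<^sub>i\<^sub>j \<parallel>\<rho> u\<^sub>i - a\<^sub>i\<^sub>j\<parallel>\<^sup>2\<close>. The dual part of \<open>\<Psi>\<close>
  telescopes exactly, and the optimality condition of the proximal step together with cocoercivity
  of the component gradients gives, with snapshot \<open>y\<close>,
  \<open>\<bbbE> D(x\<^sup>t\<^sup>+\<^sup>1) + \<bbbE> \<Psi>\<^sup>t\<^sup>+\<^sup>1 \<le> \<Psi>\<^sup>t + 2 / 5 D\<^sub>f(y)\<close>: the part of the gradient variance that stems from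
  \<open>x\<^sup>t\<close> is absorbed by cocoercivity. Averaging over an epoch yields
  \<open>m\<^sub>s \<bbbE> D(y\<^sub>s\<^sub>+\<^sub>1) + \<bbbE> \<Psi>\<^sub>s\<^sub>+\<^sub>1 \<le> \<bbbE> \<Psi>\<^sub>s + 2 / 5 m\<^sub>s \<bbbE> D\<^sub>f(y\<^sub>s)\<close>, and since \<open>m\<^sub>s \<le> 2 m\<^sub>s\<^sub>-\<^sub>1\<close> the left-hand side
  does not increase with \<open>s\<close>. So \<open>\<bbbE> D(y\<^sub>S\<^sub>+\<^sub>1) = O((E + V L) / m\<^sub>S)\<close>. In the first epoch only
  \<open>D\<^sub>f(x\<^sup>0) \<le> L / 2 \<parallel>x\<^sup>0 - x\<^sup>\<star>\<parallel>\<^sup>2\<close> occurs, so no term \<open>V\<close> without the factor \<open>L\<close> arises.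
\<close>

section \<open>The subspaces of finitely supported sequences\<close>

lemma subspace_Rn: "subspace (Rn n)"
  by (auto simp: subspace_def Rn_def)

lemmas Rn_add = subspace_add [OF subspace_Rn]
  and Rn_diff = subspace_diff [OF subspace_Rn]
  and Rn_scaleR = subspace_scale [OF subspace_Rn]
  and Rn_sum = subspace_sum [OF subspace_Rn]

lemma power2_norm_diff_scaleR:
  fixes a b :: "'a :: real_inner"
  shows "(norm (a - t *\<^sub>R b))\<^sup>2 = (norm a)\<^sup>2 - 2 * t * (a \<bullet> b) + t\<^sup>2 * (norm b)\<^sup>2"
  unfolding power2_norm_eq_inner
  by (simp add: inner_diff_left inner_diff_right inner_commute algebra_simps power2_eq_square)

lemma power2_norm_diff_le:
  fixes a b :: "'a :: real_inner"
  shows "(norm (a - b))\<^sup>2 \<le> 2 * ((norm a)\<^sup>2 + (norm b)\<^sup>2)"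
  using dot_norm [of a b] dot_norm_neg [of a b] zero_le_power2 [of "norm (a + b)"] by argo

lemma coord_sum: "coord (\<Sum>a\<in>A. f a) k = (\<Sum>a\<in>A. coord (f a) k)"
  by (induction A rule: infinite_finite_induct) auto

lemma inner_Rn:
  assumes "x \<in> Rn n"
  shows "x \<bullet> y = (\<Sum>k<n. coord x k * coord y k)"
  by (rule inner_fvec_eq_sum) (use assms in \<open>auto simp: Rn_def not_less [symmetric]\<close>)

lift_definition unit_fvec :: "nat \<Rightarrow> fvec" is "\<lambda>j k. if k = j then 1 else 0"
  by simp

lemma coord_unit_fvec [simp]: "coord (unit_fvec j) k = (if k = j then 1 else 0)"
  by transfer simp

lemma unit_fvec_in_Rn: "j < n \<Longrightarrow> unit_fvec j \<in> Rn n"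
  by (simp add: Rn_def)

lemma Rn_expansion:
  assumes "x \<in> Rn n"
  shows "x = (\<Sum>k<n. coord x k *\<^sub>R unit_fvec k)"
  using assms by (auto simp: fvec_eq_iff coord_sum Rn_def if_distrib cong: if_cong)

text \<open>The values of \<open>f\<close> on the first \<open>n\<close> unit vectors are the
  coordinates of the representing vector. The ambient space of finitely supported sequences is not
  complete, so the representation is confined to \<open>Rn n\<close>.\<close>

lemma Rn_riesz:
  assumes "linear f"
  shows "\<exists>g\<in>Rn n. \<forall>y\<in>Rn n. f y = g \<bullet> y"
proof (intro bexI ballI)
  let ?g = "\<Sum>k<n. f (unit_fvec k) *\<^sub>R unit_fvec k"
  show g: "?g \<in> Rn n"
    by (intro Rn_sum Rn_scaleR unit_fvec_in_Rn) simp
  fix y assume "y \<in> Rn n"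
  then have "f y = (\<Sum>k<n. coord y k * f (unit_fvec k))"
    using assms by (subst Rn_expansion) (auto simp: linear_sum linear_scale)
  also have "\<dots> = ?g \<bullet> y"
    by (simp add: inner_Rn [OF g] coord_sum if_distrib mult.commute cong: if_cong)
  finally show "f y = ?g \<bullet> y" .
qed

text \<open>Finitely many coordinates decide: each coordinate of a Cauchy sequence in
  \<open>Rn n\<close> converges, and the squared distance to the assembled limit is a finite sum
  tending to zero.\<close>

lemma complete_Rn: "uniform_space_class.complete (Rn n)"
proof (rule completeI)
  fix X :: "nat \<Rightarrow> fvec"
  assume X: "\<forall>m. X m \<in> Rn n" and "Cauchy X"
  have le: "\<bar>coord x k\<bar> \<le> norm x" if "x \<in> Rn n" for x k
  proof (cases "k < n")
    case True
    have "(coord x k)\<^sup>2 \<le> (\<Sum>k<n. (coord x k)\<^sup>2)"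
      using True by (intro member_le_sum) auto
    also have "\<dots> = (norm x)\<^sup>2"
      unfolding power2_norm_eq_inner inner_Rn [OF that] by (simp add: power2_eq_square)
    finally show ?thesis
      by (metis abs_le_square_iff abs_norm_cancel)
  qed (use that in \<open>auto simp: Rn_def\<close>)
  have "\<exists>c. (\<lambda>m. coord (X m) k) \<longlonglongrightarrow> c" for k
  proof -
    have "Cauchy (\<lambda>m. coord (X m) k)"
    proof (rule metric_CauchyI)
      fix e :: real assume "e > 0"
      then obtain M where M: "\<And>p q. p \<ge> M \<Longrightarrow> q \<ge> M \<Longrightarrow> dist (X p) (X q) < e"
        using \<open>Cauchy X\<close> by (metis Cauchy_def)
      have "dist (coord (X p) k) (coord (X q) k) \<le> dist (X p) (X q)" for p q
        using le [OF Rn_diff, of "X p" "X q" k] X by (simp add: dist_norm)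
      with M show "\<exists>M. \<forall>p\<ge>M. \<forall>q\<ge>M. dist (coord (X p) k) (coord (X q) k) < e"
        by (meson le_less_trans)
    qed
    then show ?thesis
      by (metis real_Cauchy_convergent convergent_def)
  qed
  then obtain c where c: "\<And>k. (\<lambda>m. coord (X m) k) \<longlonglongrightarrow> c k"
    by metis
  define x where "x = (\<Sum>k<n. c k *\<^sub>R unit_fvec k)"
  have x: "x \<in> Rn n"
    unfolding x_def by (intro Rn_sum Rn_scaleR unit_fvec_in_Rn) simp
  have coord_x: "coord x k = c k" if "k < n" for k
    using that by (simp add: x_def coord_sum if_distrib cong: if_cong)
  have "(\<lambda>m. (norm (X m - x))\<^sup>2) \<longlonglongrightarrow> 0"
  proof -
    have "(norm (X m - x))\<^sup>2 = (\<Sum>k<n. (coord (X m) k - c k)\<^sup>2)" for m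
      using X x unfolding power2_norm_eq_inner
      by (subst inner_Rn [OF Rn_diff]) (auto simp: coord_x power2_eq_square)
    moreover have "(\<lambda>m. \<Sum>k<n. (coord (X m) k - c k)\<^sup>2) \<longlonglongrightarrow> (\<Sum>k<n. (c k - c k)\<^sup>2)"
      by (intro tendsto_intros c)
    ultimately show ?thesis by simp
  qed
  then have "(\<lambda>m. norm (X m - x)) \<longlonglongrightarrow> 0"
    using tendsto_real_sqrt by fastforce
  then have "X \<longlonglongrightarrow> x"
    by (simp add: LIM_zero_iff tendsto_norm_zero_iff)
  with x show "\<exists>x\<in>Rn n. X \<longlonglongrightarrow> x" by blast
qed

section \<open>Gradients and smooth convex functions\<close>

text \<open>Composition with a line that stays inside \<open>Rn n\<close> reduces questions about
  derivatives within \<open>Rn n\<close> to calculus in one variable.\<close>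

lemma has_derivative_along_line:
  assumes "(f has_derivative f') (at (x + t *\<^sub>R d) within Rn n)" "x \<in> Rn n" "d \<in> Rn n"
  shows "((\<lambda>t. f (x + t *\<^sub>R d)) has_real_derivative f' d) (at t)"
proof -
  have "((\<lambda>t. x + t *\<^sub>R d) has_derivative (\<lambda>s. s *\<^sub>R d)) (at t)"
    by (auto intro!: derivative_eq_intros)
  moreover have "range (\<lambda>t. x + t *\<^sub>R d) \<subseteq> Rn n"
    using assms by (auto intro: Rn_add Rn_scaleR)
  then have "(f has_derivative f') (at (x + t *\<^sub>R d) within range (\<lambda>t. x + t *\<^sub>R d))"
    by (rule has_derivative_subset [OF assms(1)])
  ultimately have "((\<lambda>t. f (x + t *\<^sub>R d)) has_derivative (\<lambda>s. f' (s *\<^sub>R d))) (at t)"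
    by (rule has_derivative_in_compose)
  moreover have "linear f'"
    using assms(1) has_derivative_linear by blast
  ultimately show ?thesis
    by (simp add: has_field_derivative_def linear_scale mult.commute [of _ "f' d"] mult_commute_abs)
qed

lemma grad_eqI:
  assumes "(f has_derivative (\<lambda>y. g \<bullet> y)) (at x within Rn n)" "x \<in> Rn n" "g \<in> Rn n"
  shows "grad n f x = g"
  unfolding grad_def
proof (rule the_equality)
  fix g'
  assume g': "g' \<in> Rn n \<and> (f has_derivative (\<lambda>y. g' \<bullet> y)) (at x within Rn n)"
  \<comment> \<open>Both derivatives are tested in the direction of the difference of the
    candidates. It lies in \<open>Rn n\<close> since both candidates do, and it turns out orthogonal
    to itself.\<close>
  define d where "d = g' - g"
  have "d \<in> Rn n"
    using g' assms by (simp add: d_def Rn_diff)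
  with g' assms has_derivative_along_line [of f _ x 0 d n]
  have "g' \<bullet> d = g \<bullet> d"
    by (metis (no_types, lifting) DERIV_unique add.right_neutral scaleR_zero_left)
  then have "d \<bullet> d = 0"
    by (simp add: d_def inner_diff_left)
  then show "g' = g"
    by (simp add: d_def)
qed (use assms in blast)

lemma
  assumes "f differentiable_on Rn n" "x \<in> Rn n"
  shows grad_in_Rn: "grad n f x \<in> Rn n"
    and has_derivative_grad: "(f has_derivative (\<lambda>y. grad n f x \<bullet> y)) (at x within Rn n)"
proof -
  obtain f' where f': "(f has_derivative f') (at x within Rn n)"
    using assms by (auto simp: differentiable_on_def differentiable_def)
  then obtain g where g: "g \<in> Rn n" "\<And>y. y \<in> Rn n \<Longrightarrow> f' y = g \<bullet> y"
    using Rn_riesz has_derivative_linear by metis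
  have "(f has_derivative (\<lambda>y. g \<bullet> y)) (at x within Rn n)"
    unfolding has_derivative_within
  proof (intro conjI bounded_linear_inner_right)
    have "((\<lambda>y. (1 / norm (y - x)) *\<^sub>R (f y - (f x + f' (y - x)))) \<longlongrightarrow> 0) (at x within Rn n)"
      using f' by (simp add: has_derivative_within)
    \<comment> \<open>\<open>f'\<close> and the inner product with \<open>g\<close> agree on
      \<open>Rn n\<close> only; this is enough because every difference \<open>y - x\<close> in the
      limit lies there.\<close>
    then show "((\<lambda>y. (1 / norm (y - x)) *\<^sub>R (f y - (f x + g \<bullet> (y - x)))) \<longlongrightarrow> 0) (at x within Rn n)"
      by (rule Lim_transform_eventually)
        (use g assms(2) in \<open>auto simp: eventually_at_filter Rn_diff\<close>)
  qed
  moreover from this have "grad n f x = g"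
    using grad_eqI g assms by blast
  ultimately show "grad n f x \<in> Rn n"
    and "(f has_derivative (\<lambda>y. grad n f x \<bullet> y)) (at x within Rn n)"
    using g by simp_all
qed

text \<open>The restriction of \<open>f\<close> to the line through \<open>x\<close> and
  \<open>y\<close> is convex on the reals, so the one-variable tangent inequality applies between
  the parameters 0 and 1.\<close>

lemma grad_tangent:
  assumes "convex_on (Rn n) f" "f differentiable_on Rn n" "x \<in> Rn n" "y \<in> Rn n"
  shows "f y \<ge> f x + grad n f x \<bullet> (y - x)"
proof -
  let ?\<phi> = "\<lambda>t. f (x + t *\<^sub>R (y - x))"
  have d: "y - x \<in> Rn n" using assms by (simp add: Rn_diff)
  have "convex_on UNIV ?\<phi>"
  proof (intro convex_onI)
    fix t a b :: real assume t: "0 < t" "t < 1"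
    let ?p = "\<lambda>a. x + a *\<^sub>R (y - x)"
    have "f ((1 - t) *\<^sub>R ?p a + t *\<^sub>R ?p b) \<le> (1 - t) * f (?p a) + t * f (?p b)"
      using t assms d by (intro convex_onD [OF assms(1)]) (auto intro!: Rn_add Rn_scaleR)
    moreover have "(1 - t) *\<^sub>R ?p a + t *\<^sub>R ?p b = ?p ((1 - t) *\<^sub>R a + t *\<^sub>R b)"
      by (simp add: algebra_simps)
    ultimately show "f (?p ((1 - t) *\<^sub>R a + t *\<^sub>R b)) \<le> (1 - t) * f (?p a) + t * f (?p b)"
      by simp
  qed auto
  moreover have "(?\<phi> has_real_derivative grad n f x \<bullet> (y - x)) (at 0)"
    using assms d by (intro has_derivative_along_line) (simp_all add: has_derivative_grad)
  ultimately have "?\<phi> 1 - ?\<phi> 0 \<ge> (grad n f x \<bullet> (y - x)) * (1 - 0)"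
    by (intro convex_on_imp_above_tangent [where A = UNIV]) auto
  then show ?thesis by simp
qed

lemma smooth_descent:
  assumes "smooth_on_Rn n L f" "x \<in> Rn n" "y \<in> Rn n"
  shows "f y \<le> f x + grad n f x \<bullet> (y - x) + L / 2 * (norm (y - x))\<^sup>2"
proof -
  define d where "d = y - x"
  have d: "d \<in> Rn n" using assms by (simp add: Rn_diff d_def)
  have diff: "f differentiable_on Rn n" and lip: "L-lipschitz_on (Rn n) (grad n f)"
    using assms by (auto simp: smooth_on_Rn_def)
  let ?p = "\<lambda>t. x + t *\<^sub>R d"
  have p: "?p t \<in> Rn n" for t using assms d by (intro Rn_add Rn_scaleR)
  \<comment> \<open>Up to the constant \<open>f x\<close>, the excess of \<open>f\<close> over the
    quadratic upper bound along the segment. The Lipschitz gradient makes its derivative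
    nonpositive, which replaces integrating the gradient.\<close>
  define \<psi> where "\<psi> t = f (?p t) - t * (grad n f x \<bullet> d) - L / 2 * t\<^sup>2 * (norm d)\<^sup>2" for t
  have "\<psi> 1 \<le> \<psi> 0"
  proof (rule DERIV_nonpos_imp_nonincreasing [where a = 0 and b = 1 and f = \<psi>])
    fix t :: real assume t: "0 \<le> t" "t \<le> 1"
    have "((\<lambda>t. f (?p t)) has_real_derivative grad n f (?p t) \<bullet> d) (at t)"
      by (rule has_derivative_along_line [OF has_derivative_grad [OF diff p] assms(2) d])
    then have deriv: "(\<psi> has_real_derivative
        (grad n f (?p t) \<bullet> d - grad n f x \<bullet> d - L * t * (norm d)\<^sup>2)) (at t)"
      unfolding \<psi>_def by (auto intro!: derivative_eq_intros)
    have "grad n f (?p t) \<bullet> d - grad n f x \<bullet> d \<le> norm (grad n f (?p t) - grad n f x) * norm d"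
      by (metis inner_diff_left norm_cauchy_schwarz)
    also have "\<dots> \<le> (L * norm (t *\<^sub>R d)) * norm d"
      using lipschitz_onD [OF lip p [of t] assms(2)]
      by (intro mult_right_mono) (simp_all add: dist_norm)
    also have "\<dots> = L * t * (norm d)\<^sup>2"
      using t by (simp add: power2_eq_square)
    finally show "\<exists>y. (\<psi> has_real_derivative y) (at t) \<and> y \<le> 0"
      using deriv by (intro exI conjI) auto
  qed simp
  then show ?thesis by (simp add: \<psi>_def d_def)
qed

lemma smooth_convex_cocoercive:
  assumes cvx: "convex_on (Rn n) f" and smooth: "smooth_on_Rn n L f" and L: "L > 0"
    and x: "x \<in> Rn n" and y: "y \<in> Rn n"
  shows "f y \<ge> f x + grad n f x \<bullet> (y - x) + (norm (grad n f y - grad n f x))\<^sup>2 / (2 * L)"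
proof -
  have diff: "f differentiable_on Rn n" using smooth by (simp add: smooth_on_Rn_def)
  define d where "d = grad n f y - grad n f x"
  \<comment> \<open>A gradient step of size \<open>1 / L\<close> from \<open>y\<close> for
    \<open>f\<close> minus the inner product with \<open>grad n f x\<close>, a function that is
    minimal at \<open>x\<close>.\<close>
  define z where "z = y - (1 / L) *\<^sub>R d"
  have z: "z \<in> Rn n"
    using x y diff by (auto simp: z_def d_def intro!: Rn_diff Rn_scaleR grad_in_Rn)
  have lower: "f x + grad n f x \<bullet> (z - x) \<le> f z"
    using grad_tangent [OF cvx diff x z] .
  have upper: "f z \<le> f y + grad n f y \<bullet> (z - y) + L / 2 * (norm (z - y))\<^sup>2"
    using smooth_descent [OF smooth y z] .
  have 1: "grad n f y \<bullet> (z - y) = - (grad n f y \<bullet> d) / L"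
    and 2: "grad n f x \<bullet> (z - x) = grad n f x \<bullet> (y - x) - (grad n f x \<bullet> d) / L"
    by (simp_all add: z_def inner_diff_right)
  have 3: "(norm (z - y))\<^sup>2 = (norm d)\<^sup>2 / L\<^sup>2"
    by (simp add: z_def power_divide power_mult_distrib)
  have 4: "grad n f y \<bullet> d - grad n f x \<bullet> d = (norm d)\<^sup>2"
    by (simp add: d_def inner_diff_left power2_norm_eq_inner)
  have "f x + grad n f x \<bullet> (y - x) + (grad n f y \<bullet> d - grad n f x \<bullet> d) / L
      - L / 2 * ((norm d)\<^sup>2 / L\<^sup>2) \<le> f y"
    using lower upper by (simp add: 1 2 3 diff_divide_distrib)
  moreover have "(norm d)\<^sup>2 / L - L / 2 * ((norm d)\<^sup>2 / L\<^sup>2) = (norm d)\<^sup>2 / (2 * L)"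
    using L by (simp add: field_simps power2_eq_square)
  ultimately show ?thesis unfolding 4 d_def [symmetric] by linarith
qed

section \<open>Closed convex functions and the proximal operator\<close>

definition effective_domain :: "nat \<Rightarrow> (fvec \<Rightarrow> ereal) \<Rightarrow> fvec set" where
  "effective_domain n h = {x \<in> Rn n. \<bar>h x\<bar> \<noteq> \<infinity>}"

text \<open>\<open>real_of_ereal\<close> sends both infinities to 0, so the value carries meaning
  only on \<open>effective_domain\<close>.\<close>

abbreviation finite_part :: "(fvec \<Rightarrow> ereal) \<Rightarrow> fvec \<Rightarrow> real" where
  "finite_part h x \<equiv> real_of_ereal (h x)"

lemma effective_domainD:
  assumes "x \<in> effective_domain n h"
  shows "x \<in> Rn n" "h x = ereal (finite_part h x)"
  using assms by (auto simp: effective_domain_def ereal_real)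

lemma effective_domain_epigraph:
  assumes "proper_closed_convex n h" "(x, r) \<in> epigraph n h"
  shows "x \<in> effective_domain n h" "finite_part h x \<le> r"
proof -
  have "x \<in> Rn n" "h x \<le> ereal r" "h x \<noteq> - \<infinity>"
    using assms by (auto simp: epigraph_def proper_closed_convex_def)
  then show "x \<in> effective_domain n h" "finite_part h x \<le> r"
    by (cases "h x"; simp add: effective_domain_def)+
qed

text \<open>Convexity is given for the epigraph: a convex combination of the graph points over
  \<open>x\<close> and \<open>y\<close> stays in it and bounds the value at the combination.\<close>

lemma convex_on_finite_part:
  assumes "proper_closed_convex n h"
  shows "convex_on (effective_domain n h) (finite_part h)"
proof -
  have comb: "(1 - t) *\<^sub>R x + t *\<^sub>R y \<in> effective_domain n h"
    "finite_part h ((1 - t) *\<^sub>R x + t *\<^sub>R y) \<le> (1 - t) * finite_part h x + t * finite_part h y"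
    if "0 \<le> t" "t \<le> 1" "x \<in> effective_domain n h" "y \<in> effective_domain n h" for t x y
  proof -
    have "(x, finite_part h x) \<in> epigraph n h" "(y, finite_part h y) \<in> epigraph n h"
      using that effective_domainD by (auto simp: epigraph_def)
    then have "(1 - t) *\<^sub>R (x, finite_part h x) + t *\<^sub>R (y, finite_part h y) \<in> epigraph n h"
      using assms that by (intro convexD) (auto simp: proper_closed_convex_def)
    then have "((1 - t) *\<^sub>R x + t *\<^sub>R y, (1 - t) * finite_part h x + t * finite_part h y)
        \<in> epigraph n h"
      by simp
    from effective_domain_epigraph [OF assms this] show
      "(1 - t) *\<^sub>R x + t *\<^sub>R y \<in> effective_domain n h"
      "finite_part h ((1 - t) *\<^sub>R x + t *\<^sub>R y) \<le> (1 - t) * finite_part h x + t * finite_part h y"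
      by auto
  qed
  show ?thesis
  proof (intro convex_onI)
    show "convex (effective_domain n h)"
      unfolding convex_alt using comb(1) by blast
  qed (use comb(2) in auto)
qed

text \<open>
  Strong convexity of the proximal objective makes a minimizing sequence Cauchy, so that no
  compactness is needed.
\<close>

lemma prox_objective_attains_minimum:
  fixes h :: "fvec \<Rightarrow> ereal" and w :: fvec
  assumes h: "proper_closed_convex n h" and v: "v \<in> subdifferential n h z" and z: "z \<in> Rn n"
    and \<gamma>: "\<gamma> > 0"
  defines "q \<equiv> \<lambda>x. finite_part h x + (norm (w - x))\<^sup>2 / (2 * \<gamma>)"
  shows "\<exists>p\<in>effective_domain n h. \<forall>x\<in>effective_domain n h. q p \<le> q x"
proof -
  let ?D = "effective_domain n h"
  have cvx: "convex_on ?D (finite_part h)" using convex_on_finite_part [OF h] .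
  have zD: "z \<in> ?D" using v z by (auto simp: subdifferential_def effective_domain_def)
  \<comment> \<open>The affine minorant from the subgradient \<open>v\<close> plus the quadratic
    term is bounded below, by completing the square.\<close>
  have "finite_part h z - \<gamma> / 2 * (norm v)\<^sup>2 + v \<bullet> (w - z) \<le> q x" if x: "x \<in> ?D" for x
  proof -
    have "h z + ereal (v \<bullet> (x - z)) \<le> h x"
      using v effective_domainD [OF x] by (simp add: subdifferential_def)
    then have "finite_part h z + v \<bullet> (x - z) \<le> finite_part h x"
      using effective_domainD(2) [OF x] effective_domainD(2) [OF zD]
      by (metis ereal_less_eq(3) plus_ereal.simps(1))
    moreover have "0 \<le> (norm (w - x - \<gamma> *\<^sub>R v))\<^sup>2 / (2 * \<gamma>)"
      using \<gamma> by simp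
    then have "0 \<le> (norm (w - x))\<^sup>2 / (2 * \<gamma>) - v \<bullet> (w - x) + \<gamma> / 2 * (norm v)\<^sup>2"
      using \<gamma> unfolding power2_norm_diff_scaleR
      by (simp add: inner_commute [of v] field_simps power2_eq_square)
    ultimately show ?thesis
      unfolding q_def by (simp add: inner_diff_right)
  qed
  then have bdd: "bdd_below (q ` ?D)" by (meson bdd_belowI2)
  define I where "I = (INF x\<in>?D. q x)"
  have I: "I \<le> q x" if "x \<in> ?D" for x
    unfolding I_def using bdd that by (rule cINF_lower)
  have "\<exists>x\<in>?D. q x < I + 1 / real (Suc m)" for m
    using cINF_less_iff [OF _ bdd, of "I + 1 / real (Suc m)"] zD by (auto simp: I_def)
  then obtain X where X: "\<And>m. X m \<in> ?D" and qX: "\<And>m. q (X m) < I + 1 / real (Suc m)"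
    by metis
  \<comment> \<open>Comparing the midpoint with \<open>I\<close> and using the parallelogram law
    shows that two nearly minimal points are close to each other.\<close>
  have strong: "(norm (a - b))\<^sup>2 \<le> 4 * \<gamma> * (q a + q b - 2 * I)" if "a \<in> ?D" "b \<in> ?D" for a b
  proof -
    let ?c = "(1 - 1/2) *\<^sub>R a + (1/2) *\<^sub>R b"
    have "?c \<in> ?D"
      using that convex_on_imp_convex [OF cvx] by (intro convexD) auto
    then have "I \<le> q ?c" by (rule I)
    moreover have "finite_part h ?c \<le> (1 - 1/2) * finite_part h a + (1/2) * finite_part h b"
      using that cvx by (intro convex_onD) auto
    moreover have "(norm (w - ?c))\<^sup>2 = (norm (w - a))\<^sup>2 / 2 + (norm (w - b))\<^sup>2 / 2 - (norm (a - b))\<^sup>2 / 4"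
      unfolding power2_norm_eq_inner
      by (simp add: inner_diff_left inner_diff_right inner_add_left inner_add_right
          inner_commute field_simps)
    ultimately have "I \<le> (finite_part h a + finite_part h b) / 2
        + ((norm (w - a))\<^sup>2 / 2 + (norm (w - b))\<^sup>2 / 2 - (norm (a - b))\<^sup>2 / 4) / (2 * \<gamma>)"
      unfolding q_def by (simp add: add_divide_distrib)
    then have "(norm (a - b))\<^sup>2 / (8 * \<gamma>) \<le> (q a + q b - 2 * I) / 2"
      unfolding q_def by (simp add: add_divide_distrib diff_divide_distrib)
    then show ?thesis using \<gamma> by (simp add: pos_divide_le_eq mult_ac)
  qed
  have "Cauchy X"
  proof (rule metric_CauchyI)
    fix e :: real assume e: "e > 0"
    obtain M where M: "1 / real (Suc M) < e\<^sup>2 / (8 * \<gamma>)"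
      using e \<gamma> by (metis nat_approx_posE divide_pos_pos zero_less_mult_iff zero_less_numeral zero_less_power)
    have "dist (X a) (X b) < e" if "a \<ge> M" "b \<ge> M" for a b
    proof -
      have *: "1 / real (Suc k) < e\<^sup>2 / (8 * \<gamma>)" if "k \<ge> M" for k
      proof -
        have "1 / real (Suc k) \<le> 1 / real (Suc M)"
          using that by (intro divide_left_mono) auto
        with M show ?thesis by linarith
      qed
      have "q (X a) + q (X b) - 2 * I < 2 * (e\<^sup>2 / (8 * \<gamma>))"
        using qX [of a] qX [of b] * [OF that(1)] * [OF that(2)] by linarith
      then have "4 * \<gamma> * (q (X a) + q (X b) - 2 * I) < e\<^sup>2"
        using \<gamma> by (simp add: field_simps)
      with strong [OF X X] have "(norm (X a - X b))\<^sup>2 < e\<^sup>2"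
        by (rule le_less_trans)
      then show ?thesis
        using e by (simp add: dist_norm power2_less_imp_less)
    qed
    then show "\<exists>M. \<forall>a\<ge>M. \<forall>b\<ge>M. dist (X a) (X b) < e" by blast
  qed
  then obtain p where p: "p \<in> Rn n" "X \<longlonglongrightarrow> p"
    using complete_Rn [of n] X effective_domainD(1) by (meson completeE)
  \<comment> \<open>The quadratic term is continuous, so the values of \<open>h\<close> along the
    sequence converge as well; closedness of the epigraph then bounds \<open>h\<close> at the limit
    point.\<close>
  have "(\<lambda>m. q (X m)) \<longlonglongrightarrow> I"
  proof (rule tendsto_sandwich [OF _ _ tendsto_const])
    show "(\<lambda>m. I + 1 / real (Suc m)) \<longlonglongrightarrow> I"
      using tendsto_add [OF tendsto_const LIMSEQ_inverse_real_of_nat, of I]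
      by (simp add: inverse_eq_divide)
  qed (use I X qX in \<open>auto intro!: always_eventually intro: less_imp_le\<close>)
  moreover have "(\<lambda>m. (norm (w - X m))\<^sup>2 / (2 * \<gamma>)) \<longlonglongrightarrow> (norm (w - p))\<^sup>2 / (2 * \<gamma>)"
    using \<gamma> p(2) by (intro tendsto_intros) auto
  ultimately have "(\<lambda>m. q (X m) - (norm (w - X m))\<^sup>2 / (2 * \<gamma>))
      \<longlonglongrightarrow> I - (norm (w - p))\<^sup>2 / (2 * \<gamma>)"
    by (rule tendsto_diff)
  then have "(\<lambda>m. finite_part h (X m)) \<longlonglongrightarrow> I - (norm (w - p))\<^sup>2 / (2 * \<gamma>)"
    by (simp add: q_def)
  with p(2) have "(\<lambda>m. (X m, finite_part h (X m))) \<longlonglongrightarrow> (p, I - (norm (w - p))\<^sup>2 / (2 * \<gamma>))"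
    by (rule tendsto_Pair)
  moreover have "(X m, finite_part h (X m)) \<in> epigraph n h" for m
    using effective_domainD [OF X [of m]] by (simp add: epigraph_def)
  ultimately have "(p, I - (norm (w - p))\<^sup>2 / (2 * \<gamma>)) \<in> epigraph n h"
    using h by (meson proper_closed_convex_def closed_sequentially)
  from effective_domain_epigraph [OF h this] have "p \<in> ?D" "q p \<le> I"
    by (simp_all add: q_def)
  then show ?thesis
    using I order_trans by blast
qed

text \<open>\<open>arg_min_on\<close> is a choice that becomes meaningful once a minimizer exists.
  The variational inequality follows by comparing the minimizer with points on the segment towards
  \<open>y\<close>, dividing by the segment parameter and letting it tend to zero.\<close>

lemma
  fixes w :: fvec
  assumes h: "proper_closed_convex n h" and v: "v \<in> subdifferential n h z" and z: "z \<in> Rn n"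
    and \<gamma>: "\<gamma> > 0"
  defines "p \<equiv> prox n \<gamma> h w"
  shows prox_in_effective_domain: "p \<in> effective_domain n h"
    and prox_variational: "y \<in> effective_domain n h \<Longrightarrow>
      finite_part h y \<ge> finite_part h p + ((1 / \<gamma>) *\<^sub>R (w - p)) \<bullet> (y - p)"
proof -
  let ?D = "effective_domain n h"
  define q where "q x = finite_part h x + (norm (w - x))\<^sup>2 / (2 * \<gamma>)" for x
  let ?F = "\<lambda>x. h x + ereal ((norm (w - x))\<^sup>2 / (2 * \<gamma>))"
  obtain p0 where p0: "p0 \<in> ?D" "\<And>x. x \<in> ?D \<Longrightarrow> q p0 \<le> q x"
    using prox_objective_attains_minimum [OF h v z \<gamma>, of w] unfolding q_def by blast
  have F: "?F x = ereal (q x)" if "x \<in> ?D" for x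
    using effective_domainD(2) [OF that] unfolding q_def by (metis plus_ereal.simps(1))
  have F': "?F x = \<infinity>" if "x \<in> Rn n" "x \<notin> ?D" for x
  proof -
    have "h x \<noteq> - \<infinity>" using h that by (auto simp: proper_closed_convex_def)
    with that show ?thesis by (auto simp: effective_domain_def)
  qed
  have "?F p0 \<le> ?F x" if "x \<in> Rn n" for x
    using F [OF p0(1)] F [of x] F' [OF that] p0(2) [of x] by (cases "x \<in> ?D") auto
  then have "is_arg_min ?F (\<lambda>x. x \<in> Rn n) p0"
    using effective_domainD(1) [OF p0(1)] by (simp add: is_arg_min_linorder)
  then have "is_arg_min ?F (\<lambda>x. x \<in> Rn n) p"
    unfolding p_def prox_def arg_min_on_def arg_min_def by (rule someI)
  then have pRn: "p \<in> Rn n" and min: "\<And>x. x \<in> Rn n \<Longrightarrow> ?F p \<le> ?F x"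
    by (auto simp: is_arg_min_linorder)
  have "?F p \<le> ereal (q p0)"
    using min [of p0] effective_domainD(1) [OF p0(1)] F [OF p0(1)] by simp
  then show pD: "p \<in> ?D"
    using F' [OF pRn] by fastforce
  have qmin: "q p \<le> q x" if "x \<in> ?D" for x
    using min [of x] that F pD effective_domainD(1) [OF that] by simp
  assume y: "y \<in> ?D"
  define c where "c = finite_part h y - finite_part h p - ((w - p) \<bullet> (y - p)) / \<gamma>"
  define b where "b = (norm (y - p))\<^sup>2 / (2 * \<gamma>)"
  have ineq: "0 \<le> c + t * b" if t: "0 < t" "t < 1" for t
  proof -
    let ?x = "(1 - t) *\<^sub>R p + t *\<^sub>R y"
    have cvx: "convex_on ?D (finite_part h)" using convex_on_finite_part [OF h] .
    have xD: "?x \<in> ?D"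
      using t y pD convex_on_imp_convex [OF cvx] by (intro convexD) auto
    have hx: "finite_part h ?x \<le> (1 - t) * finite_part h p + t * finite_part h y"
      using t y pD cvx by (intro convex_onD) auto
    have w_x: "w - ?x = (w - p) - t *\<^sub>R (y - p)" by (simp add: algebra_simps)
    have "(norm (w - ?x))\<^sup>2 / (2 * \<gamma>)
        = (norm (w - p))\<^sup>2 / (2 * \<gamma>) - t * (((w - p) \<bullet> (y - p)) / \<gamma>) + t * (t * b)"
      unfolding w_x b_def power2_norm_diff_scaleR using \<gamma>
      by (simp add: field_simps power2_eq_square)
    with qmin [OF xD] hx have "0 \<le> t * (c + t * b)"
      unfolding q_def c_def by (simp add: algebra_simps)
    with t show ?thesis by (simp add: zero_le_mult_iff)
  qed
  have "((\<lambda>t. c + t * b) \<longlongrightarrow> c + 0 * b) (at_right 0)"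
    by (intro tendsto_intros)
  moreover have "eventually (\<lambda>t. 0 \<le> c + t * b) (at_right 0)"
    using ineq by (auto simp: eventually_at_right_field intro!: exI [of _ 1])
  ultimately have "0 \<le> c + 0 * b"
    by (intro tendsto_lowerbound [of _ _ "at_right 0"]) auto
  then show "finite_part h y \<ge> finite_part h p + ((1 / \<gamma>) *\<^sub>R (w - p)) \<bullet> (y - p)"
    by (simp add: c_def)
qed

section \<open>The decentralized problem\<close>

text \<open>Both orientations of every edge, matching one dual vector per ordered pair of
  neighbours.\<close>

definition arcs :: "decentralized_problem \<Rightarrow> (nat \<times> nat) set" where
  "arcs P = Sigma (nodes P) (nbrs P)"

locale decentralized_optimum =
  fixes P :: decentralized_problem and K :: nat and L \<rho> :: real
    and xs :: "nat \<Rightarrow> fvec" and ls :: "nat \<Rightarrow> nat \<Rightarrow> fvec" and vs :: "nat \<Rightarrow> fvec"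
  assumes valid: "valid_problem P"
    and ncomp: "\<And>i. i \<in> nodes P \<Longrightarrow> ncomp P i = K"
    and smoothness: "\<And>i. i \<in> nodes P \<Longrightarrow> smoothness P i = L"
    and optimal: "optimal_triple P xs ls vs"
    and \<rho>_pos: "\<rho> > 0"
begin

abbreviation "n \<equiv> space_dim P"
abbreviation "V \<equiv> nodes P"
abbreviation "rdom i \<equiv> effective_domain n (reg P i)"

section \<open>Graph structure and optimality conditions\<close>

lemma finite_nodes [simp]: "finite V" and nodes_nonempty: "V \<noteq> {}"
  and edges_subset: "e \<in> edges P \<Longrightarrow> e \<subseteq> V" and card_edge: "e \<in> edges P \<Longrightarrow> card e = 2"
  using valid by (auto simp: valid_problem_def connected_graph_def)

lemma nbrs_in_nodes: "j \<in> nbrs P i \<Longrightarrow> j \<in> V"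
  using edges_subset by (auto simp: nbrs_def)

lemma nbrs_sym: "j \<in> nbrs P i \<longleftrightarrow> i \<in> nbrs P j"
  by (simp add: nbrs_def insert_commute)

lemma node_if_nbr: "j \<in> nbrs P i \<Longrightarrow> i \<in> V"
  using nbrs_in_nodes nbrs_sym by blast

lemma finite_nbrs [simp]: "finite (nbrs P i)"
  using nbrs_in_nodes by (auto intro: finite_subset [OF _ finite_nodes])

text \<open>The map from arcs to unordered pairs lands in the edges and has fibres of at most two
  elements.\<close>

lemma card_arcs_le: "card (arcs P) \<le> 2 * card (edges P)"
proof -
  have "edges P \<subseteq> Pow V"
    using edges_subset by blast
  then have fin: "finite (edges P)"
    by (rule finite_subset) simp
  have le2: "card {p. {fst p, snd p} = e} \<le> 2" "finite {p. {fst p, snd p} = e}"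
    if e: "e \<in> edges P" for e
  proof -
    obtain a b where "e = {a, b}"
      using card_edge [OF e] by (auto simp: card_2_iff)
    then have sub: "{p. {fst p, snd p} = e} \<subseteq> {(a, b), (b, a)}"
      by (auto simp: doubleton_eq_iff)
    then show "finite {p. {fst p, snd p} = e}" by (rule finite_subset) simp
    have "card {(a, b), (b, a)} \<le> 2" by (auto intro: card_insert_le_m1)
    with sub show "card {p. {fst p, snd p} = e} \<le> 2"
      by (meson card_mono finite.intros order_trans)
  qed
  have "arcs P \<subseteq> (\<Union>e\<in>edges P. {p. {fst p, snd p} = e})"
    by (auto simp: arcs_def nbrs_def)
  then have "card (arcs P) \<le> card (\<Union>e\<in>edges P. {p. {fst p, snd p} = e})"
    using fin le2 by (intro card_mono) auto
  also have "\<dots> \<le> (\<Sum>e\<in>edges P. card {p. {fst p, snd p} = e})"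
    by (rule card_UN_le [OF fin])
  also have "\<dots> \<le> card (edges P) * 2"
    using sum_bounded_above [of "edges P" "\<lambda>e. card {p. {fst p, snd p} = e}" 2] le2 by simp
  finally show ?thesis by simp
qed

lemma sum_arcs_swap: "(\<Sum>(i, j)\<in>arcs P. f j i) = (\<Sum>(i, j)\<in>arcs P. f i j)"
  by (rule sum.reindex_bij_witness [where i = prod.swap and j = prod.swap])
    (auto simp: arcs_def nbrs_sym dest: nbrs_in_nodes node_if_nbr)

lemma K_pos: "K \<ge> 1" and L_pos: "L > 0"
  using valid nodes_nonempty ncomp smoothness by (auto simp: valid_problem_def)

lemma component_convex: "i \<in> V \<Longrightarrow> k \<in> {1..K} \<Longrightarrow> convex_on (Rn n) (component P i k)"
  and component_smooth: "i \<in> V \<Longrightarrow> k \<in> {1..K} \<Longrightarrow> smooth_on_Rn n L (component P i k)"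
  and reg_closed_convex: "i \<in> V \<Longrightarrow> proper_closed_convex n (reg P i)"
  using valid ncomp smoothness by (auto simp: valid_problem_def)

lemma component_differentiable:
  "i \<in> V \<Longrightarrow> k \<in> {1..K} \<Longrightarrow> component P i k differentiable_on Rn n"
  using component_smooth by (auto simp: smooth_on_Rn_def)

lemma xs_in_Rn: "i \<in> V \<Longrightarrow> xs i \<in> Rn n"
  and xs_nbrs: "i \<in> V \<Longrightarrow> j \<in> nbrs P i \<Longrightarrow> xs j = xs i"
  and vs_subdifferential: "i \<in> V \<Longrightarrow> vs i \<in> subdifferential n (reg P i) (xs i)"
  using optimal by (auto simp: optimal_triple_def is_arg_min_def feasible_def)

lemma ls_antisym: "i \<in> V \<Longrightarrow> j \<in> nbrs P i \<Longrightarrow> ls j i = - ls i j"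
  using optimal by (auto simp: optimal_triple_def eq_neg_iff_add_eq_0 add.commute)

lemma xs_in_dom: "i \<in> V \<Longrightarrow> xs i \<in> rdom i"
  using vs_subdifferential xs_in_Rn by (auto simp: subdifferential_def effective_domain_def)

text \<open>Antisymmetry replaces the incoming multipliers \<open>ls j i\<close> of the stationarity
  condition by outgoing ones, the orientation in which the new duals \<open>l' i j\<close> enter at
  node \<open>i\<close>.\<close>

lemma vs_eq:
  assumes "i \<in> V"
  shows "vs i = (\<Sum>j\<in>nbrs P i. ls i j) - grad n (loss P i) (xs i)"
proof -
  have "vs i + grad n (loss P i) (xs i) + (\<Sum>j\<in>nbrs P i. ls j i) = 0"
    using optimal assms by (auto simp: optimal_triple_def)
  moreover have "(\<Sum>j\<in>nbrs P i. ls j i) = - (\<Sum>j\<in>nbrs P i. ls i j)"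
    using ls_antisym assms by (simp add: sum_negf [symmetric])
  ultimately show ?thesis by (simp add: algebra_simps eq_neg_iff_add_eq_0)
qed

subsection \<open>The local losses\<close>

text \<open>The expectation over one uniformly sampled component, written as a finite sum so that
  the one-step estimate stays free of probability.\<close>

definition avg :: "(nat \<Rightarrow> real) \<Rightarrow> real" where
  "avg \<phi> = (\<Sum>k = 1..K. \<phi> k) / real K"

lemma avg_mono: "(\<And>k. k \<in> {1..K} \<Longrightarrow> \<phi> k \<le> \<psi> k) \<Longrightarrow> avg \<phi> \<le> avg \<psi>"
  unfolding avg_def by (intro divide_right_mono sum_mono) auto

lemma avg_add: "avg (\<lambda>k. \<phi> k + \<psi> k) = avg \<phi> + avg \<psi>"
  and avg_diff: "avg (\<lambda>k. \<phi> k - \<psi> k) = avg \<phi> - avg \<psi>"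
  and avg_cmult: "avg (\<lambda>k. c * \<phi> k) = c * avg \<phi>"
  and avg_divide: "avg (\<lambda>k. \<phi> k / c) = avg \<phi> / c"
  by (simp_all add: avg_def sum.distrib sum_subtractf add_divide_distrib diff_divide_distrib
      sum_distrib_left [symmetric] sum_divide_distrib [symmetric])

lemma avg_const [simp]: "avg (\<lambda>k. c) = c"
  using K_pos by (simp add: avg_def)

lemma avg_nonneg: "(\<And>k. k \<in> {1..K} \<Longrightarrow> 0 \<le> \<phi> k) \<Longrightarrow> 0 \<le> avg \<phi>"
  using avg_mono [of "\<lambda>_. 0" \<phi>] by simp

lemma loss_eq_avg: "i \<in> V \<Longrightarrow> loss P i x = avg (\<lambda>k. component P i k x)"
  by (simp add: loss_def avg_def ncomp)

lemma grad_loss: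
  assumes i: "i \<in> V" and x: "x \<in> Rn n"
  shows "grad n (loss P i) x = (1 / real K) *\<^sub>R (\<Sum>k = 1..K. grad n (component P i k) x)"
proof -
  let ?g = "(1 / real K) *\<^sub>R (\<Sum>k = 1..K. grad n (component P i k) x)"
  have g: "?g \<in> Rn n"
    using i x by (auto intro!: Rn_scaleR Rn_sum grad_in_Rn component_differentiable)
  have "((\<lambda>x. \<Sum>k = 1..K. component P i k x) has_derivative
      (\<lambda>y. \<Sum>k = 1..K. grad n (component P i k) x \<bullet> y)) (at x within Rn n)"
    using i x by (intro has_derivative_sum has_derivative_grad component_differentiable) auto
  then have "((\<lambda>x. (\<Sum>k = 1..K. component P i k x) * (1 / real K)) has_derivative
      (\<lambda>y. (\<Sum>k = 1..K. grad n (component P i k) x \<bullet> y) * (1 / real K))) (at x within Rn n)"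
    by (rule has_derivative_mult_left)
  then have "(loss P i has_derivative (\<lambda>y. ?g \<bullet> y)) (at x within Rn n)"
    using i by (simp add: loss_def [abs_def] ncomp inner_sum_left)
  then show ?thesis
    by (rule grad_eqI [OF _ x g])
qed

lemma grad_loss_inner:
  "i \<in> V \<Longrightarrow> x \<in> Rn n \<Longrightarrow> grad n (loss P i) x \<bullet> d = avg (\<lambda>k. grad n (component P i k) x \<bullet> d)"
  by (simp add: grad_loss avg_def inner_sum_left)

lemma loss_descent:
  assumes "i \<in> V" "x \<in> Rn n" "y \<in> Rn n"
  shows "loss P i y \<le> loss P i x + grad n (loss P i) x \<bullet> (y - x) + L / 2 * (norm (y - x))\<^sup>2"
proof -
  have "avg (\<lambda>k. component P i k y) \<le> avg (\<lambda>k. component P i k x +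
      grad n (component P i k) x \<bullet> (y - x) + L / 2 * (norm (y - x))\<^sup>2)"
    using assms component_smooth by (intro avg_mono smooth_descent) auto
  then show ?thesis
    using assms by (simp add: loss_eq_avg grad_loss_inner avg_add)
qed

text \<open>Averaging the component inequalities keeps the mean squared component difference. This
  is stronger than the squared difference of the averaged gradients, and it is what controls the
  sampling variance.\<close>

lemma loss_cocoercive:
  assumes "i \<in> V" "x \<in> Rn n" "y \<in> Rn n"
  shows "loss P i y \<ge> loss P i x + grad n (loss P i) x \<bullet> (y - x) +
    avg (\<lambda>k. (norm (grad n (component P i k) y - grad n (component P i k) x))\<^sup>2) / (2 * L)"
proof -
  have "avg (\<lambda>k. component P i k y) \<ge> avg (\<lambda>k. component P i k x +
      grad n (component P i k) x \<bullet> (y - x) +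
      (norm (grad n (component P i k) y - grad n (component P i k) x))\<^sup>2 / (2 * L))"
    using assms component_smooth component_convex L_pos
    by (intro avg_mono smooth_convex_cocoercive) auto
  then show ?thesis
    using assms by (simp add: loss_eq_avg grad_loss_inner avg_add avg_divide)
qed

lemma convex_on_loss:
  assumes "i \<in> V"
  shows "convex_on (Rn n) (loss P i)"
proof (intro convex_onI)
  fix t :: real and a b assume *: "0 < t" "t < 1" "a \<in> Rn n" "b \<in> Rn n"
  have "avg (\<lambda>k. component P i k ((1 - t) *\<^sub>R a + t *\<^sub>R b)) \<le>
      avg (\<lambda>k. (1 - t) * component P i k a + t * component P i k b)"
    using * component_convex [OF assms] by (intro avg_mono convex_onD) auto
  then show "loss P i ((1 - t) *\<^sub>R a + t *\<^sub>R b) \<le> (1 - t) * loss P i a + t * loss P i b"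
    using assms by (simp add: loss_eq_avg avg_add avg_cmult)
qed (use subspace_Rn subspace_imp_convex in auto)

subsection \<open>Bregman divergences\<close>

definition loss_gap :: "nat \<Rightarrow> fvec \<Rightarrow> real" where
  "loss_gap i z = bregman n (loss P i) z (xs i)"

text \<open>The real-valued counterpart of \<open>bregman_total\<close>, with which it agrees on
  \<open>rdom i\<close>; the algebra of an iteration can then be done in the reals.\<close>

definition gap :: "nat \<Rightarrow> fvec \<Rightarrow> real" where
  "gap i z = loss_gap i z +
     (finite_part (reg P i) z - finite_part (reg P i) (xs i) - vs i \<bullet> (z - xs i))"

lemma bregman_total_eq_gap:
  assumes "i \<in> V" "z \<in> rdom i"
  shows "bregman_total P i (vs i) z (xs i) = ereal (gap i z)"
proof -
  obtain a b where "reg P i z = ereal a" "reg P i (xs i) = ereal b"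
    using effective_domainD(2) assms xs_in_dom by meson
  then show ?thesis
    by (simp add: bregman_total_def bregman_sub_def gap_def loss_gap_def)
qed

text \<open>Cocoercivity based at \<open>xs i\<close> gives the first two bounds, the descent
  inequality the third. The third serves the initial snapshot.\<close>

lemma
  assumes "i \<in> V" "z \<in> Rn n"
  shows gradient_variance_le_loss_gap:
      "avg (\<lambda>k. (norm (grad n (component P i k) z - grad n (component P i k) (xs i)))\<^sup>2)
        \<le> 2 * L * loss_gap i z"
    and loss_gap_nonneg: "0 \<le> loss_gap i z"
    and loss_gap_le: "loss_gap i z \<le> L / 2 * (norm (z - xs i))\<^sup>2"
proof -
  let ?v = "avg (\<lambda>k. (norm (grad n (component P i k) z - grad n (component P i k) (xs i)))\<^sup>2)"
  have "?v / (2 * L) \<le> loss_gap i z"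
    using loss_cocoercive [of i "xs i" z] assms xs_in_Rn by (simp add: loss_gap_def bregman_def)
  then show v: "?v \<le> 2 * L * loss_gap i z"
    using L_pos by (simp add: field_simps)
  have "0 \<le> ?v" by (intro avg_nonneg) simp
  with v L_pos show "0 \<le> loss_gap i z"
    by (smt (verit) mult_pos_neg)
  show "loss_gap i z \<le> L / 2 * (norm (z - xs i))\<^sup>2"
    using loss_descent [of i "xs i" z] assms xs_in_Rn by (simp add: loss_gap_def bregman_def)
qed

lemma loss_gap_le_gap:
  assumes "i \<in> V" "z \<in> rdom i"
  shows "loss_gap i z \<le> gap i z"
proof -
  obtain a b where *: "reg P i z = ereal a" "reg P i (xs i) = ereal b"
    using effective_domainD(2) assms xs_in_dom by meson
  have "reg P i (xs i) + ereal (vs i \<bullet> (z - xs i)) \<le> reg P i z"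
    using vs_subdifferential assms effective_domainD(1) by (auto simp: subdifferential_def)
  with * show ?thesis by (simp add: gap_def)
qed

lemma gap_nonneg: "i \<in> V \<Longrightarrow> z \<in> rdom i \<Longrightarrow> 0 \<le> gap i z"
  using loss_gap_le_gap loss_gap_nonneg effective_domainD(1) by (meson order_trans)

text \<open>\<open>gap i\<close> differs from the sum of loss and regularizer by a function affine
  in its argument, so it inherits their convexity.\<close>

lemma
  assumes i: "i \<in> V" and t: "0 \<le> t" "t \<le> 1" and ab: "a \<in> rdom i" "b \<in> rdom i"
  shows dom_combination: "(1 - t) *\<^sub>R a + t *\<^sub>R b \<in> rdom i"
    and gap_combination: "gap i ((1 - t) *\<^sub>R a + t *\<^sub>R b) \<le> (1 - t) * gap i a + t * gap i b"
proof -
  let ?c = "(1 - t) *\<^sub>R a + t *\<^sub>R b" and ?h = "finite_part (reg P i)"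
  have cvx: "convex_on (rdom i) ?h"
    using convex_on_finite_part reg_closed_convex i by blast
  show "?c \<in> rdom i"
    using t ab convex_on_imp_convex [OF cvx] by (intro convexD) auto
  have "?h ?c \<le> (1 - t) * ?h a + t * ?h b"
    using t ab cvx by (intro convex_onD) auto
  moreover have "loss P i ?c \<le> (1 - t) * loss P i a + t * loss P i b"
    using t ab effective_domainD(1) by (intro convex_onD [OF convex_on_loss [OF i]]) auto
  ultimately show "gap i ?c \<le> (1 - t) * gap i a + t * gap i b"
    by (simp add: gap_def loss_gap_def bregman_def inner_add_right inner_diff_right algebra_simps)
qed

section \<open>One inner iteration\<close>

definition dual_potential :: "(nat \<Rightarrow> fvec) \<Rightarrow> (nat \<Rightarrow> nat \<Rightarrow> fvec) \<Rightarrow> real" where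
  "dual_potential x l =
     (\<Sum>(i, j)\<in>arcs P. (norm (\<rho> *\<^sub>R (x i - xs i) - (l i j - ls i j)))\<^sup>2) / (4 * \<rho>)"

text \<open>For the step size \<open>1 / (6 * L)\<close> the weight \<open>3 * L\<close> is half the
  inverse step size, the usual weight of the proximal distance.\<close>

definition potential :: "(nat \<Rightarrow> fvec) \<Rightarrow> (nat \<Rightarrow> nat \<Rightarrow> fvec) \<Rightarrow> real" where
  "potential x l = (\<Sum>i\<in>V. 3 * L * (norm (x i - xs i))\<^sup>2) + dual_potential x l"

lemma potential_nonneg: "0 \<le> potential x l"
  unfolding potential_def dual_potential_def using L_pos \<rho>_pos
  by (auto intro!: add_nonneg_nonneg sum_nonneg divide_nonneg_nonneg mult_nonneg_nonneg)

text \<open>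
  With \<open>u = x - x\<^sup>\<star>\<close> and \<open>a = \<lambda> - \<lambda>\<^sup>\<star>\<close>, the dual update reads
  \<open>\<rho> u'\<^sub>i + a'\<^sub>i\<^sub>j = \<rho> u\<^sub>j - a\<^sub>j\<^sub>i\<close>, and
  \<open>4 \<rho> \<langle>a', u'\<rangle> = \<parallel>\<rho> u' + a'\<parallel>\<^sup>2 - \<parallel>\<rho> u' - a'\<parallel>\<^sup>2\<close>.
\<close>

lemma dual_telescoping:
  assumes l': "l' = dual_update \<rho> x x' l"
  shows "(\<Sum>i\<in>V. (\<Sum>j\<in>nbrs P i. l' i j - ls i j) \<bullet> (x' i - xs i))
    = dual_potential x l - dual_potential x' l'"
proof -
  let ?u = "\<lambda>i. x i - xs i" and ?u' = "\<lambda>i. x' i - xs i"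
  let ?a = "\<lambda>i j. l i j - ls i j" and ?a' = "\<lambda>i j. l' i j - ls i j"
  have polar: "?a' i j \<bullet> ?u' i =
      ((norm (\<rho> *\<^sub>R ?u j - ?a j i))\<^sup>2 - (norm (\<rho> *\<^sub>R ?u' i - ?a' i j))\<^sup>2) / (4 * \<rho>)"
    if "(i, j) \<in> arcs P" for i j
  proof -
    \<comment> \<open>The optimal parts match by consensus, \<open>xs j = xs i\<close>, and by
      antisymmetry of \<open>ls\<close>.\<close>
    have eq: "\<rho> *\<^sub>R ?u j - ?a j i = \<rho> *\<^sub>R ?u' i + ?a' i j"
      using that xs_nbrs [of i j] ls_antisym [of i j]
      by (simp add: arcs_def l' dual_update_def algebra_simps)
    have "(norm (b + a))\<^sup>2 - (norm (b - a))\<^sup>2 = 4 * (a \<bullet> b)" for a b :: fvec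
      unfolding power2_norm_eq_inner
      by (simp add: inner_add_left inner_add_right inner_diff_left inner_diff_right inner_commute)
    then show ?thesis
      unfolding eq using \<rho>_pos by simp
  qed
  have "(\<Sum>i\<in>V. (\<Sum>j\<in>nbrs P i. ?a' i j) \<bullet> ?u' i) = (\<Sum>(i, j)\<in>arcs P. ?a' i j \<bullet> ?u' i)"
    by (simp add: inner_sum_left arcs_def sum.Sigma)
  also have "\<dots> = (\<Sum>(i, j)\<in>arcs P.
      ((norm (\<rho> *\<^sub>R ?u j - ?a j i))\<^sup>2 - (norm (\<rho> *\<^sub>R ?u' i - ?a' i j))\<^sup>2) / (4 * \<rho>))"
    using polar by (intro sum.cong) auto
  also have "\<dots> = ((\<Sum>(i, j)\<in>arcs P. (norm (\<rho> *\<^sub>R ?u j - ?a j i))\<^sup>2)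
      - (\<Sum>(i, j)\<in>arcs P. (norm (\<rho> *\<^sub>R ?u' i - ?a' i j))\<^sup>2)) / (4 * \<rho>)"
    by (simp add: case_prod_beta sum_divide_distrib [symmetric] sum_subtractf)
  \<comment> \<open>The old terms are indexed by the reversed arc; the set of arcs is closed under
    reversal.\<close>
  also have "\<dots> = dual_potential x l - dual_potential x' l'"
    by (subst sum_arcs_swap) (simp add: dual_potential_def diff_divide_distrib)
  finally show ?thesis .
qed

abbreviation "\<eta> \<equiv> (\<lambda>i::nat. 1 / (6 * L))"

section \<open>The primal step at one node and the mean of its noise\<close>

definition sampling_error :: "(nat \<Rightarrow> fvec) \<Rightarrow> (nat \<Rightarrow> fvec) \<Rightarrow> nat \<Rightarrow> nat \<Rightarrow> fvec" where
  "sampling_error y x i k = vr_gradient P y x i k - grad n (loss P i) (x i)"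

text \<open>The surplus of cocoercivity over the plain tangent inequality between \<open>z\<close>
  and \<open>xs i\<close>. It is reserved to pay for the variance caused by the current
  iterate.\<close>

definition slack :: "nat \<Rightarrow> fvec \<Rightarrow> real" where
  "slack i z =
     avg (\<lambda>k. (norm (grad n (component P i k) z - grad n (component P i k) (xs i)))\<^sup>2) / (2 * L)"

text \<open>Collects the sample-dependent terms of the one-step bound and the slack that compensates
  them. The inner product is with the old iterate, which is fixed before sampling, so it averages to
  zero.\<close>

definition noise :: "(nat \<Rightarrow> fvec) \<Rightarrow> (nat \<Rightarrow> fvec) \<Rightarrow> nat \<Rightarrow> nat \<Rightarrow> real" where
  "noise y x i k = (norm (sampling_error y x i k))\<^sup>2 / (10 * L)
     - sampling_error y x i k \<bullet> (x i - xs i) - slack i (x i)"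

text \<open>The proximal inequality is tested at \<open>xs i\<close>; its subgradient contains the
  updated duals. Descent from \<open>x i\<close> to \<open>x' i\<close> and cocoercivity between
  \<open>x i\<close> and \<open>xs i\<close> handle the loss.\<close>

lemma
  fixes y :: "nat \<Rightarrow> fvec" and l :: "nat \<Rightarrow> nat \<Rightarrow> fvec" and k :: "nat \<Rightarrow> nat"
  assumes i: "i \<in> V" and x: "x i \<in> Rn n"
  defines "x' \<equiv> primal_update P \<rho> \<eta> k y x l"
  defines "l' \<equiv> dual_update \<rho> x x' l"
  shows primal_update_in_dom: "x' i \<in> rdom i"
    and node_step: "gap i (x' i) + 3 * L * (norm (x' i - xs i))\<^sup>2
      \<le> 3 * L * (norm (x i - xs i))\<^sup>2 + noise y x i (k i)
        + (\<Sum>j\<in>nbrs P i. l' i j - ls i j) \<bullet> (x' i - xs i)"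
proof -
  \<comment> \<open>The inverse of the proximal parameter for the step size
    \<open>1 / (6 * L)\<close>.\<close>
  define c where "c = 6 * L + \<rho> * real (card (nbrs P i))"
  define g where "g = vr_gradient P y x i (k i)"
  define w where "w = (1 / c * (6 * L)) *\<^sub>R (x i - (1 / (6 * L)) *\<^sub>R g) +
    (1 / c) *\<^sub>R (\<Sum>j\<in>nbrs P i. \<rho> *\<^sub>R x j - l j i)"
  have c: "c > 0"
    unfolding c_def using L_pos \<rho>_pos by (intro add_pos_nonneg) auto
  have x'_prox: "x' i = prox n (1 / c) (reg P i) w"
    unfolding x'_def primal_update_def Let_def w_def c_def g_def
    by (simp add: inverse_eq_divide)
  note prox = prox_in_effective_domain [OF reg_closed_convex vs_subdifferential xs_in_Rn]
    prox_variational [OF reg_closed_convex vs_subdifferential xs_in_Rn]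
  show x'_dom: "x' i \<in> rdom i"
    unfolding x'_prox using i c by (intro prox) auto
  have x'_Rn: "x' i \<in> Rn n" using effective_domainD(1) [OF x'_dom] .
  define e where "e = sampling_error y x i (k i)"
  define u where "u = x i - xs i"
  define u' where "u' = x' i - xs i"
  define \<delta> where "\<delta> = x' i - x i"
  define v' where "v' = (1 / (1 / c)) *\<^sub>R (w - x' i)"
  define s where "s = (\<Sum>j\<in>nbrs P i. l' i j - ls i j)"
  have "finite_part (reg P i) (xs i) \<ge> finite_part (reg P i) (x' i) + v' \<bullet> (xs i - x' i)"
    unfolding x'_prox v'_def using i c xs_in_dom by (intro prox) auto
  moreover have "v' \<bullet> (xs i - x' i) = - (v' \<bullet> u')"
    by (simp add: u'_def inner_diff_right)
  ultimately have "gap i (x' i) \<le> loss_gap i (x' i) + (v' - vs i) \<bullet> u'"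
    by (simp add: gap_def u'_def inner_diff_left)
  \<comment> \<open>Multiplication by \<open>c\<close> yields one copy of
    \<open>\<rho> *\<^sub>R x' i\<close> per neighbour; subtracted from the terms
    \<open>\<rho> *\<^sub>R x j - l j i\<close>, these copies produce exactly the updated
    duals.\<close>
  moreover have "v' - vs i = s - (6 * L) *\<^sub>R \<delta> - g + grad n (loss P i) (xs i)"
  proof -
    have "c *\<^sub>R w = (6 * L) *\<^sub>R x i - g + (\<Sum>j\<in>nbrs P i. \<rho> *\<^sub>R x j - l j i)"
      unfolding w_def using c L_pos by (simp add: scaleR_add_right scaleR_diff_right)
    moreover have "c *\<^sub>R x' i = (6 * L) *\<^sub>R x' i + (\<Sum>j\<in>nbrs P i. \<rho> *\<^sub>R x' i)"
      by (simp add: c_def scaleR_add_left sum_constant_scaleR mult.commute)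
    moreover have "(\<Sum>j\<in>nbrs P i. l' i j) =
        (\<Sum>j\<in>nbrs P i. \<rho> *\<^sub>R x j - l j i) - (\<Sum>j\<in>nbrs P i. \<rho> *\<^sub>R x' i)"
      unfolding l'_def dual_update_def sum_subtractf [symmetric]
      by (intro sum.cong) (auto simp: algebra_simps)
    ultimately have "v' = (\<Sum>j\<in>nbrs P i. l' i j) - (6 * L) *\<^sub>R \<delta> - g"
      unfolding v'_def \<delta>_def using c by (simp add: scaleR_diff_right)
    then show ?thesis
      by (simp add: s_def sum_subtractf vs_eq [OF i])
  qed
  moreover have "loss_gap i (x' i) \<le> (grad n (loss P i) (x i) - grad n (loss P i) (xs i)) \<bullet> u'
      + L / 2 * (norm \<delta>)\<^sup>2 - slack i (x i)"
  proof -
    have "loss P i (x' i) \<le> loss P i (x i) + grad n (loss P i) (x i) \<bullet> \<delta> + L / 2 * (norm \<delta>)\<^sup>2"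
      unfolding \<delta>_def by (rule loss_descent [OF i x x'_Rn])
    moreover have "loss P i (xs i) \<ge> loss P i (x i) + grad n (loss P i) (x i) \<bullet> (xs i - x i)
        + slack i (x i)"
      using loss_cocoercive [OF i x xs_in_Rn [OF i]] by (simp add: slack_def norm_minus_commute)
    moreover have "grad n (loss P i) (x i) \<bullet> u' =
        grad n (loss P i) (x i) \<bullet> \<delta> - grad n (loss P i) (x i) \<bullet> (xs i - x i)"
      by (simp add: u'_def \<delta>_def inner_diff_right)
    ultimately show ?thesis
      by (simp add: loss_gap_def bregman_def u'_def inner_diff_left)
  qed
  moreover have "g = grad n (loss P i) (x i) + e"
    by (simp add: e_def sampling_error_def g_def)
  ultimately have main: "gap i (x' i) \<le> L / 2 * (norm \<delta>)\<^sup>2 - slack i (x i) - e \<bullet> u'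
      - 6 * L * (\<delta> \<bullet> u') + s \<bullet> u'"
    by (simp add: inner_diff_left inner_add_left)
  \<comment> \<open>Splitting off \<open>e \<bullet> u\<close> isolates the term that averages to
    zero; only \<open>e \<bullet> \<delta>\<close> has to be estimated.\<close>
  have "e \<bullet> u' = e \<bullet> u + e \<bullet> \<delta>"
    by (simp add: u_def u'_def \<delta>_def inner_diff_right)
  moreover have "6 * L * (\<delta> \<bullet> u') =
      3 * L * (norm u')\<^sup>2 + 3 * L * (norm \<delta>)\<^sup>2 - 3 * L * (norm u)\<^sup>2"
    unfolding power2_norm_eq_inner u_def u'_def \<delta>_def
    by (simp add: inner_diff_left inner_diff_right inner_commute algebra_simps)
  \<comment> \<open>Young's inequality, weighted so that its \<open>5 * L / 2\<close> and the
    \<open>L / 2\<close> from descent add up to the \<open>3 * L\<close> gained from the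
    polarization identity above.\<close>
  moreover have "- (e \<bullet> \<delta>) \<le> (norm e)\<^sup>2 / (10 * L) + 5 * L / 2 * (norm \<delta>)\<^sup>2"
  proof -
    have "0 \<le> (norm (e + (5 * L) *\<^sub>R \<delta>))\<^sup>2 / (10 * L)"
      using L_pos by simp
    also have "\<dots> = (norm e)\<^sup>2 / (10 * L) + e \<bullet> \<delta> + 5 * L / 2 * (norm \<delta>)\<^sup>2"
      unfolding power2_norm_eq_inner using L_pos
      by (simp add: inner_add_left inner_add_right inner_commute field_simps)
    finally show ?thesis by simp
  qed
  ultimately have "L / 2 * (norm \<delta>)\<^sup>2 - e \<bullet> u' - 6 * L * (\<delta> \<bullet> u')
      \<le> (norm e)\<^sup>2 / (10 * L) - e \<bullet> u + 3 * L * (norm u)\<^sup>2 - 3 * L * (norm u')\<^sup>2"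
    by (simp add: field_simps)
  with main show "gap i (x' i) + 3 * L * (norm (x' i - xs i))\<^sup>2
      \<le> 3 * L * (norm (x i - xs i))\<^sup>2 + noise y x i (k i)
        + (\<Sum>j\<in>nbrs P i. l' i j - ls i j) \<bullet> (x' i - xs i)"
    unfolding noise_def e_def [symmetric] u_def [symmetric] u'_def [symmetric] s_def [symmetric]
    by linarith
qed

lemma iteration_step:
  fixes y :: "nat \<Rightarrow> fvec" and l :: "nat \<Rightarrow> nat \<Rightarrow> fvec" and k :: "nat \<Rightarrow> nat"
  assumes x: "\<forall>i\<in>V. x i \<in> Rn n"
  defines "x' \<equiv> primal_update P \<rho> \<eta> k y x l"
  shows "(\<Sum>i\<in>V. gap i (x' i)) + potential x' (dual_update \<rho> x x' l)
    \<le> potential x l + (\<Sum>i\<in>V. noise y x i (k i))"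
proof -
  let ?l' = "dual_update \<rho> x x' l"
  have "(\<Sum>i\<in>V. gap i (x' i) + 3 * L * (norm (x' i - xs i))\<^sup>2)
      \<le> (\<Sum>i\<in>V. 3 * L * (norm (x i - xs i))\<^sup>2 + noise y x i (k i)
        + (\<Sum>j\<in>nbrs P i. ?l' i j - ls i j) \<bullet> (x' i - xs i))"
    unfolding x'_def using x by (intro sum_mono node_step) auto
  then show ?thesis
    using dual_telescoping [of ?l' x x' l]
    by (simp add: sum.distrib potential_def)
qed

text \<open>The variance is at most the mean square of the component differences, which is split at
  \<open>xs i\<close>. The current iterate contributes \<open>2 / 5\<close> of its slack, covered by
  the full slack subtracted in \<open>noise\<close>; the snapshot contributes the right-hand
  side.\<close>

lemma avg_noise_le:
  assumes i: "i \<in> V" and x: "x i \<in> Rn n" and y: "y i \<in> Rn n"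
  shows "avg (noise y x i) \<le> 2 / 5 * loss_gap i (y i)"
proof -
  let ?G = "\<lambda>k. grad n (component P i k)" and ?e = "sampling_error y x i"
  let ?p = "\<lambda>k. ?G k (x i) - ?G k (xs i)" and ?q = "\<lambda>k. ?G k (y i) - ?G k (xs i)"
  let ?d = "\<lambda>k. ?G k (x i) - ?G k (y i)"
  define b where "b = grad n (loss P i) (x i) - grad n (loss P i) (y i)"
  have e: "?e k = ?d k - b" for k
    by (simp add: sampling_error_def vr_gradient_def b_def)
  have avg_d: "avg (\<lambda>k. ?d k \<bullet> z) = b \<bullet> z" for z
    using i x y by (simp add: inner_diff_left avg_diff b_def grad_loss_inner)
  have mean: "avg (\<lambda>k. ?e k \<bullet> z) = 0" for z
    by (simp add: e inner_diff_left [of _ b] avg_diff avg_d)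
  have "avg (\<lambda>k. (norm (?e k))\<^sup>2) = avg (\<lambda>k. (norm (?d k))\<^sup>2 - 2 * (?d k \<bullet> b) + (norm b)\<^sup>2)"
    unfolding e by (intro arg_cong [of _ _ avg] ext) (simp add: power2_norm_diff_scaleR [of _ 1, simplified])
  also have "\<dots> = avg (\<lambda>k. (norm (?d k))\<^sup>2) - (norm b)\<^sup>2"
    by (simp add: avg_add avg_diff avg_cmult avg_d power2_norm_eq_inner)
  also have "\<dots> \<le> avg (\<lambda>k. (norm (?d k))\<^sup>2)" by simp
  also have "\<dots> \<le> avg (\<lambda>k. 2 * (norm (?p k))\<^sup>2 + 2 * (norm (?q k))\<^sup>2)"
  proof (rule avg_mono)
    fix k
    from power2_norm_diff_le [of "?p k" "?q k"]
    show "(norm (?d k))\<^sup>2 \<le> 2 * (norm (?p k))\<^sup>2 + 2 * (norm (?q k))\<^sup>2" by simp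
  qed
  also have "\<dots> = 4 * L * slack i (x i) + 2 * avg (\<lambda>k. (norm (?q k))\<^sup>2)"
    using L_pos by (simp add: avg_add avg_cmult slack_def)
  also have "\<dots> \<le> 4 * L * slack i (x i) + 4 * L * loss_gap i (y i)"
    using gradient_variance_le_loss_gap [OF i y] by simp
  finally have "avg (\<lambda>k. (norm (?e k))\<^sup>2) / (10 * L)
      \<le> (4 * L * slack i (x i) + 4 * L * loss_gap i (y i)) / (10 * L)"
    using L_pos by (intro divide_right_mono) auto
  also have "\<dots> = 2 / 5 * slack i (x i) + 2 / 5 * loss_gap i (y i)"
    using L_pos by (simp add: field_simps)
  finally have "avg (\<lambda>k. (norm (?e k))\<^sup>2) / (10 * L)
      \<le> 2 / 5 * slack i (x i) + 2 / 5 * loss_gap i (y i)" .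
  moreover have "0 \<le> slack i (x i)"
    unfolding slack_def using L_pos by (intro divide_nonneg_nonneg avg_nonneg) auto
  moreover have "avg (noise y x i) = avg (\<lambda>k. (norm (?e k))\<^sup>2) / (10 * L) - slack i (x i)"
    unfolding noise_def by (simp add: avg_diff avg_divide mean)
  ultimately show ?thesis by linarith
qed

section \<open>Expectations over the epochs\<close>

text \<open>The bound is a sum of functions of single coordinates, so its expectation is read off
  from the uniform marginals. The sample space has finite support, which makes every function
  integrable.\<close>

lemma nn_integral_sample_le:
  fixes c :: real
  assumes nonneg: "\<And>k. 0 \<le> G k"
    and le: "\<And>k. G k \<le> c + (\<Sum>i\<in>V. q i (k i))"
    and avg_le: "\<And>i. i \<in> V \<Longrightarrow> avg (q i) \<le> b i"
  shows "(\<integral>\<^sup>+ k. ennreal (G k) \<partial>sample_indices P) \<le> ennreal (c + (\<Sum>i\<in>V. b i))"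
proof -
  let ?M = "sample_indices P"
  have fin: "finite (set_pmf ?M)"
    unfolding sample_indices_def using K_pos
    by (auto simp: set_Pi_pmf ncomp intro!: finite_PiE_dflt)
  note int = integrable_measure_pmf_finite [OF fin]
  have marginal: "(\<integral>k. q i (k i) \<partial>?M) = avg (q i)" if "i \<in> V" for i
  proof -
    have "map_pmf (\<lambda>k. k i) ?M = pmf_of_set {1..K}"
      using that by (simp add: sample_indices_def Pi_pmf_component ncomp)
    then have "(\<integral>k. q i (k i) \<partial>?M) = (\<integral>k. q i k \<partial>pmf_of_set {1..K})"
      by (metis integral_map_pmf)
    also have "\<dots> = avg (q i)"
      using K_pos by (simp add: integral_pmf_of_set avg_def)
    finally show ?thesis .
  qed
  have "(\<integral>\<^sup>+ k. ennreal (G k) \<partial>?M) = ennreal (\<integral>k. G k \<partial>?M)"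
    using nonneg by (intro nn_integral_eq_integral int) auto
  also have "(\<integral>k. G k \<partial>?M) \<le> (\<integral>k. c + (\<Sum>i\<in>V. q i (k i)) \<partial>?M)"
    by (intro integral_mono int le)
  also have "\<dots> = c + (\<Sum>i\<in>V. avg (q i))"
    using marginal by (simp add: Bochner_Integration.integral_add int Bochner_Integration.integral_sum)
  also have "\<dots> \<le> c + (\<Sum>i\<in>V. b i)"
    using avg_le by (intro add_left_mono sum_mono)
  finally show ?thesis
    by (meson ennreal_leI order_trans order.refl)
qed

text \<open>Jensen's inequality one point at a time: the new average is a convex combination with
  weight \<open>1 / real (Suc t)\<close> on \<open>z\<close>. For \<open>t = 0\<close> there is no
  previous average, and the formula \<open>(1 / real t) *\<^sub>R a\<close> gives 0, which may lie
  outside the domain; hence the case distinction.\<close>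

lemma
  assumes i: "i \<in> V" and z: "z \<in> rdom i"
    and a: "if t = 0 then a = 0 else (1 / real t) *\<^sub>R a \<in> rdom i"
  shows average_step_in_dom: "(1 / real (Suc t)) *\<^sub>R (a + z) \<in> rdom i"
    and average_step_gap: "real (Suc t) * gap i ((1 / real (Suc t)) *\<^sub>R (a + z))
      \<le> real t * gap i ((1 / real t) *\<^sub>R a) + gap i z"
proof -
  let ?\<theta> = "1 / real (Suc t)"
  have "?\<theta> *\<^sub>R (a + z) \<in> rdom i \<and>
    real (Suc t) * gap i (?\<theta> *\<^sub>R (a + z)) \<le> real t * gap i ((1 / real t) *\<^sub>R a) + gap i z"
  proof (cases "t = 0")
    case False
    then have a': "(1 / real t) *\<^sub>R a \<in> rdom i" using a by simp
    have \<theta>: "0 \<le> ?\<theta>" "?\<theta> \<le> 1" by auto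
    have \<theta>': "1 - ?\<theta> = real t / real (Suc t)" by (simp add: field_simps)
    have eq: "?\<theta> *\<^sub>R (a + z) = (1 - ?\<theta>) *\<^sub>R ((1 / real t) *\<^sub>R a) + ?\<theta> *\<^sub>R z"
      unfolding \<theta>' using False by (simp add: scaleR_add_right)
    have "gap i (?\<theta> *\<^sub>R (a + z)) \<le> (1 - ?\<theta>) * gap i ((1 / real t) *\<^sub>R a) + ?\<theta> * gap i z"
      unfolding eq by (rule gap_combination [OF i \<theta> a' z])
    then have "real (Suc t) * gap i (?\<theta> *\<^sub>R (a + z))
        \<le> real (Suc t) * (real t / real (Suc t) * gap i ((1 / real t) *\<^sub>R a) + ?\<theta> * gap i z)"
      unfolding \<theta>' by (intro mult_left_mono) auto
    also have "\<dots> = real t * gap i ((1 / real t) *\<^sub>R a) + gap i z"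
      by (simp add: distrib_left del: of_nat_Suc)
    finally show ?thesis
      unfolding eq using dom_combination [OF i \<theta> a' z] by simp
  qed (use a z in simp)
  then show "(1 / real (Suc t)) *\<^sub>R (a + z) \<in> rdom i"
    and "real (Suc t) * gap i ((1 / real (Suc t)) *\<^sub>R (a + z))
      \<le> real t * gap i ((1 / real t) *\<^sub>R a) + gap i z"
    by simp_all
qed

section \<open>The inner loop in expectation\<close>

lemma inner_loop_support:
  assumes "\<forall>i\<in>V. x0 i \<in> rdom i"
    and "(x, l, acc) \<in> set_pmf (inner_loop P \<rho> \<eta> y x0 l0 t)" and "i \<in> V"
  shows "x i \<in> rdom i" and "if t = 0 then acc i = 0 else (1 / real t) *\<^sub>R acc i \<in> rdom i"
proof -
  have "x i \<in> rdom i \<and> (if t = 0 then acc i = 0 else (1 / real t) *\<^sub>R acc i \<in> rdom i)"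
    using assms(2)
  proof (induction t arbitrary: x l acc)
    case (Suc t)
    then obtain x1 l1 acc1 k where
      prev: "(x1, l1, acc1) \<in> set_pmf (inner_loop P \<rho> \<eta> y x0 l0 t)"
      and x: "x = primal_update P \<rho> \<eta> k y x1 l1" and acc: "acc = (\<lambda>i. acc1 i + x i)"
      by (auto simp: Let_def)
    have IH: "x1 i \<in> rdom i" "if t = 0 then acc1 i = 0 else (1 / real t) *\<^sub>R acc1 i \<in> rdom i"
      using Suc.IH [OF prev] by auto
    have xi: "x i \<in> rdom i"
      unfolding x using primal_update_in_dom [of i x1, OF assms(3)] effective_domainD(1) [OF IH(1)] .
    moreover have "(1 / real (Suc t)) *\<^sub>R acc i \<in> rdom i"
      using average_step_in_dom [OF assms(3) xi IH(2)] by (simp add: acc)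
    ultimately show ?case by simp
  qed (use assms in auto)
  then show "x i \<in> rdom i" and "if t = 0 then acc i = 0 else (1 / real t) *\<^sub>R acc i \<in> rdom i"
    by auto
qed

text \<open>Per iteration the conditional expectation grows by at most the snapshot term: the scaled
  gap of the running average increases by at most the new gap, which \<open>iteration_step\<close>
  charges to the potential. At \<open>t = 0\<close> the factor \<open>real t\<close> removes the
  meaningless average.\<close>

lemma inner_loop_bound:
  assumes x0: "\<forall>i\<in>V. x0 i \<in> rdom i" and y: "\<forall>i\<in>V. y i \<in> Rn n"
  shows "(\<integral>\<^sup>+ (x, l, acc). ennreal (real t * (\<Sum>i\<in>V. gap i ((1 / real t) *\<^sub>R acc i)) + potential x l)
      \<partial>inner_loop P \<rho> \<eta> y x0 l0 t)
    \<le> ennreal (potential x0 l0 + real t * (\<Sum>i\<in>V. 2 / 5 * loss_gap i (y i)))"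
proof (induction t)
  case (Suc t)
  let ?b = "\<Sum>i\<in>V. 2 / 5 * loss_gap i (y i)"
  let ?F = "\<lambda>t (x, l, acc). ennreal (real t * (\<Sum>i\<in>V. gap i ((1 / real t) *\<^sub>R acc i)) + potential x l)"
  have b: "0 \<le> ?b"
    using loss_gap_nonneg y by (auto intro!: sum_nonneg)
  have step: "(\<integral>\<^sup>+ k. ?F (Suc t) (primal_update P \<rho> \<eta> k y x l,
        dual_update \<rho> x (primal_update P \<rho> \<eta> k y x l) l, \<lambda>i. acc i + primal_update P \<rho> \<eta> k y x l i)
        \<partial>sample_indices P)
      \<le> ?F t (x, l, acc) + ennreal ?b"
    if supp: "(x, l, acc) \<in> set_pmf (inner_loop P \<rho> \<eta> y x0 l0 t)" for x l acc
  proof -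
    have x: "\<forall>i\<in>V. x i \<in> Rn n"
      using inner_loop_support(1) [OF x0 supp] effective_domainD(1) by auto
    note acc = inner_loop_support(2) [OF x0 supp]
    let ?x' = "\<lambda>k. primal_update P \<rho> \<eta> k y x l"
    let ?l' = "\<lambda>k. dual_update \<rho> x (?x' k)"
    let ?z = "\<lambda>k i. (1 / real (Suc t)) *\<^sub>R (acc i + ?x' k i)"
    let ?S = "\<Sum>i\<in>V. gap i ((1 / real t) *\<^sub>R acc i)"
    have x'_dom: "?x' k i \<in> rdom i" if "i \<in> V" for i k
      using primal_update_in_dom that x by blast
    have z: "?z k i \<in> rdom i"
      "real (Suc t) * gap i (?z k i) \<le> real t * gap i ((1 / real t) *\<^sub>R acc i) + gap i (?x' k i)"
      if "i \<in> V" for i k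
      using average_step_in_dom [OF that x'_dom [OF that] acc [OF that]]
        average_step_gap [OF that x'_dom [OF that] acc [OF that]] by blast+
    have S: "0 \<le> real t * ?S"
    proof (cases "t = 0")
      case False
      then show ?thesis
        using acc gap_nonneg by (auto intro!: mult_nonneg_nonneg sum_nonneg)
    qed simp
    have "(\<integral>\<^sup>+ k. ennreal (real (Suc t) * (\<Sum>i\<in>V. gap i (?z k i)) + potential (?x' k) (?l' k l))
        \<partial>sample_indices P) \<le> ennreal ((real t * ?S + potential x l) + ?b)"
    proof (rule nn_integral_sample_le)
      fix k
      show "0 \<le> real (Suc t) * (\<Sum>i\<in>V. gap i (?z k i)) + potential (?x' k) (?l' k l)"
        using z(1) gap_nonneg potential_nonneg
        by (intro add_nonneg_nonneg mult_nonneg_nonneg sum_nonneg) auto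
      have "real (Suc t) * (\<Sum>i\<in>V. gap i (?z k i)) \<le> real t * ?S + (\<Sum>i\<in>V. gap i (?x' k i))"
        using z(2) unfolding sum_distrib_left sum.distrib [symmetric] by (intro sum_mono)
      with iteration_step [OF x, of k y l]
      show "real (Suc t) * (\<Sum>i\<in>V. gap i (?z k i)) + potential (?x' k) (?l' k l)
          \<le> (real t * ?S + potential x l) + (\<Sum>i\<in>V. noise y x i (k i))"
        by linarith
    qed (use avg_noise_le x y in auto)
    also have "\<dots> = ennreal (real t * ?S + potential x l) + ennreal ?b"
      using S b potential_nonneg by (intro ennreal_plus add_nonneg_nonneg) auto
    finally show ?thesis by simp
  qed
  \<comment> \<open>Conditioning on the state after \<open>t\<close> iterations; the estimate is
    available on the support, where the iterates lie in the effective domains.\<close>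
  have "(\<integral>\<^sup>+ s. ?F (Suc t) s \<partial>inner_loop P \<rho> \<eta> y x0 l0 (Suc t))
      \<le> (\<integral>\<^sup>+ s. ?F t s + ennreal ?b \<partial>inner_loop P \<rho> \<eta> y x0 l0 t)"
    unfolding inner_loop.simps nn_integral_bind_pmf
    using step
    by (intro nn_integral_mono_AE) (auto simp: AE_measure_pmf_iff Let_def nn_integral_bind_pmf)
  also have "\<dots> = (\<integral>\<^sup>+ s. ?F t s \<partial>inner_loop P \<rho> \<eta> y x0 l0 t) + ennreal ?b"
    by (subst nn_integral_add) auto
  also have "\<dots> \<le> ennreal (potential x0 l0 + real t * ?b) + ennreal ?b"
    by (intro add_right_mono Suc.IH)
  also have "\<dots> = ennreal (potential x0 l0 + real (Suc t) * ?b)"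
    using b potential_nonneg by (subst ennreal_plus [symmetric]) (auto simp: algebra_simps)
  finally show ?case .
qed simp

section \<open>The epochs in expectation\<close>

lemma svrpd_support:
  assumes x0: "\<forall>i\<in>V. x0 i \<in> rdom i" and m: "\<forall>s\<ge>1. m s \<ge> 1"
    and "(x, l, y) \<in> set_pmf (svrpd P \<rho> \<eta> m x0 l0 s)" and i: "i \<in> V"
  shows "x i \<in> rdom i" "y i \<in> rdom i"
proof -
  have "\<forall>i\<in>V. x i \<in> rdom i \<and> y i \<in> rdom i"
    using assms(3)
  proof (induction s arbitrary: x l y)
    case (Suc s)
    then obtain x1 l1 y1 acc where
      prev: "(x1, l1, y1) \<in> set_pmf (svrpd P \<rho> \<eta> m x0 l0 s)"
      and loop: "(x, l, acc) \<in> set_pmf (inner_loop P \<rho> \<eta> y1 x1 l1 (m (Suc s)))"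
      and y: "y = (\<lambda>i. (1 / real (m (Suc s))) *\<^sub>R acc i)"
      by auto
    have "\<forall>i\<in>V. x1 i \<in> rdom i"
      using Suc.IH [OF prev] by blast
    note supp = inner_loop_support [OF this loop]
    have "m (Suc s) \<noteq> 0" using spec [OF m, of "Suc s"] by simp
    with supp show ?case by (auto simp: y)
  qed (use x0 in auto)
  with i show "x i \<in> rdom i" "y i \<in> rdom i" by auto
qed

text \<open>An epoch charges \<open>2 / 5\<close> of the snapshot gap per iteration and is at most
  twice as long as its predecessor, so the charge is at most \<open>4 / 5\<close> of the weighted
  gap left by that predecessor. The induction starts after the first epoch, whose snapshot is
  \<open>x0\<close>.\<close>

lemma svrpd_bound:
  assumes x0: "\<forall>i\<in>V. x0 i \<in> rdom i" and m: "\<forall>s\<ge>1. m s \<ge> 1"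
    and double: "\<forall>s\<ge>1. m (Suc s) \<le> 2 * m s"
  shows "(\<integral>\<^sup>+ (x, l, y). ennreal (real (m (Suc s)) * (\<Sum>i\<in>V. gap i (y i)) + potential x l)
      \<partial>svrpd P \<rho> \<eta> m x0 l0 (Suc s))
    \<le> ennreal (potential x0 l0 + real (m 1) * (\<Sum>i\<in>V. 2 / 5 * loss_gap i (x0 i)))"
proof (induction s)
  case 0
  have "m 1 \<noteq> 0" using spec [OF m, of 1] by simp
  moreover have "\<forall>i\<in>V. x0 i \<in> Rn n"
    using effective_domainD(1) x0 by blast
  ultimately show ?case
    using inner_loop_bound [OF x0, where t = "m 1" and y = x0 and ?l0.0 = l0]
    by (simp add: bind_return_pmf nn_integral_bind_pmf case_prod_unfold)
next
  case (Suc s)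
  let ?s = "Suc s"
  have step: "(\<integral>\<^sup>+ (x', l', acc). ennreal (real (m (Suc ?s)) *
        (\<Sum>i\<in>V. gap i ((1 / real (m (Suc ?s))) *\<^sub>R acc i)) + potential x' l')
        \<partial>inner_loop P \<rho> \<eta> y x l (m (Suc ?s)))
      \<le> ennreal (real (m ?s) * (\<Sum>i\<in>V. gap i (y i)) + potential x l)"
    if supp: "(x, l, y) \<in> set_pmf (svrpd P \<rho> \<eta> m x0 l0 ?s)" for x l y
  proof -
    note dom = svrpd_support [OF x0 m supp]
    have "real (m (Suc ?s)) * (\<Sum>i\<in>V. 2 / 5 * loss_gap i (y i))
        \<le> real (2 * m ?s) * (\<Sum>i\<in>V. 2 / 5 * gap i (y i))"
    proof (intro mult_mono sum_mono)
      show "real (m (Suc ?s)) \<le> real (2 * m ?s)"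
        using spec [OF double, of ?s] by simp
      show "0 \<le> (\<Sum>i\<in>V. 2 / 5 * loss_gap i (y i))"
        using loss_gap_nonneg [OF _ effective_domainD(1) [OF dom(2)]]
        by (intro sum_nonneg mult_nonneg_nonneg) auto
    qed (use loss_gap_nonneg [OF _ effective_domainD(1) [OF dom(2)]] dom(2) loss_gap_le_gap in auto)
    also have "\<dots> = 4 / 5 * (real (m ?s) * (\<Sum>i\<in>V. gap i (y i)))"
      by (simp add: sum_distrib_left [symmetric] sum_divide_distrib [symmetric])
    also have "\<dots> \<le> real (m ?s) * (\<Sum>i\<in>V. gap i (y i))"
    proof -
      have "0 \<le> real (m ?s) * (\<Sum>i\<in>V. gap i (y i))"
        using dom(2) gap_nonneg by (intro mult_nonneg_nonneg sum_nonneg) auto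
      then show ?thesis by linarith
    qed
    finally have le: "potential x l + real (m (Suc ?s)) * (\<Sum>i\<in>V. 2 / 5 * loss_gap i (y i))
        \<le> real (m ?s) * (\<Sum>i\<in>V. gap i (y i)) + potential x l" by simp
    have "\<forall>i\<in>V. x i \<in> rdom i" "\<forall>i\<in>V. y i \<in> Rn n"
      using effective_domainD(1) dom by blast+
    then show ?thesis
      using inner_loop_bound [of x y] ennreal_leI [OF le] order_trans by blast
  qed
  have "(\<integral>\<^sup>+ (x, l, y). ennreal (real (m (Suc ?s)) * (\<Sum>i\<in>V. gap i (y i)) + potential x l)
      \<partial>svrpd P \<rho> \<eta> m x0 l0 (Suc ?s))
    \<le> (\<integral>\<^sup>+ (x, l, y). ennreal (real (m ?s) * (\<Sum>i\<in>V. gap i (y i)) + potential x l)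
      \<partial>svrpd P \<rho> \<eta> m x0 l0 ?s)"
    unfolding svrpd.simps(2) [of _ _ _ _ _ _ ?s] nn_integral_bind_pmf
    using step
    by (intro nn_integral_mono_AE)
      (auto simp: AE_measure_pmf_iff nn_integral_bind_pmf case_prod_unfold simp del: svrpd.simps)
  with Suc.IH show ?case by (rule order_trans [rotated])
qed

text \<open>On the support the extended divergence is the real \<open>gap\<close>; dropping the
  nonnegative potential and dividing \<open>svrpd_bound\<close> by the epoch length leaves the
  claim.\<close>

lemma expected_divergence_le:
  assumes x0: "\<forall>i\<in>V. x0 i \<in> rdom i" and m: "\<forall>s\<ge>1. m s \<ge> 1"
    and double: "\<forall>s\<ge>1. m (Suc s) \<le> 2 * m s"
  shows "expected_divergence P \<rho> \<eta> m x0 l0 xs vs (Suc s)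
    \<le> ennreal ((potential x0 l0 + real (m 1) * (\<Sum>i\<in>V. 2 / 5 * loss_gap i (x0 i))) / real (m (Suc s)))"
proof -
  let ?M = "svrpd P \<rho> \<eta> m x0 l0 (Suc s)"
  let ?B = "potential x0 l0 + real (m 1) * (\<Sum>i\<in>V. 2 / 5 * loss_gap i (x0 i))"
  let ?c = "1 / real (m (Suc s))"
  have ms: "real (m (Suc s)) > 0" using spec [OF m, of "Suc s"] by simp
  have "expected_divergence P \<rho> \<eta> m x0 l0 xs vs (Suc s) =
      (\<integral>\<^sup>+ s. (\<Sum>i\<in>V. case s of (x, l, y) \<Rightarrow> e2ennreal (bregman_total P i (vs i) (y i) (xs i))) \<partial>?M)"
    unfolding expected_divergence_def by (subst nn_integral_sum) auto
  also have "\<dots> \<le> (\<integral>\<^sup>+ r. ennreal ?c * (case r of (x, l, y) \<Rightarrow>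
      ennreal (real (m (Suc s)) * (\<Sum>i\<in>V. gap i (y i)) + potential x l)) \<partial>?M)"
  proof (intro nn_integral_mono_AE, unfold AE_measure_pmf_iff, intro ballI)
    fix r assume "r \<in> set_pmf ?M"
    moreover obtain x l y where r: "r = (x, l, y)" by (cases r)
    ultimately have y: "y i \<in> rdom i" if "i \<in> V" for i
      using svrpd_support(2) [OF x0 m _ that] by blast
    have "(\<Sum>i\<in>V. e2ennreal (bregman_total P i (vs i) (y i) (xs i))) = (\<Sum>i\<in>V. ennreal (gap i (y i)))"
      using y by (intro sum.cong) (auto simp: bregman_total_eq_gap)
    also have "\<dots> = ennreal (\<Sum>i\<in>V. gap i (y i))"
      using y gap_nonneg by (intro sum_ennreal) auto
    also have "\<dots> \<le> ennreal (?c * (real (m (Suc s)) * (\<Sum>i\<in>V. gap i (y i)) + potential x l))"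
      using ms potential_nonneg [of x l] by (intro ennreal_leI) (simp add: distrib_left)
    also have "\<dots> = ennreal ?c * ennreal (real (m (Suc s)) * (\<Sum>i\<in>V. gap i (y i)) + potential x l)"
      by (intro ennreal_mult') simp
    finally show "(\<Sum>i\<in>V. case r of (x, l, y) \<Rightarrow> e2ennreal (bregman_total P i (vs i) (y i) (xs i)))
        \<le> ennreal ?c * (case r of (x, l, y) \<Rightarrow>
          ennreal (real (m (Suc s)) * (\<Sum>i\<in>V. gap i (y i)) + potential x l))"
      by (simp add: r)
  qed
  also have "\<dots> = ennreal ?c * (\<integral>\<^sup>+ (x, l, y).
      ennreal (real (m (Suc s)) * (\<Sum>i\<in>V. gap i (y i)) + potential x l) \<partial>?M)"
    by (intro nn_integral_cmult) auto
  also have "\<dots> \<le> ennreal ?c * ennreal ?B"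
    by (intro mult_left_mono svrpd_bound x0 m double) auto
  also have "\<dots> = ennreal (?B / real (m (Suc s)))"
    by (subst ennreal_mult' [symmetric]) (auto simp: ms)
  finally show ?thesis .
qed

lemma initial_potential_le:
  assumes "initial_bound P xs ls vs x0 l0 W"
  shows "potential x0 l0 + real M * (\<Sum>i\<in>V. 2 / 5 * loss_gap i (x0 i))
    \<le> (3 + \<rho> + 1 / \<rho> + real M) * W * (real (card (edges P)) + real (card V) * L)"
    and "i \<in> V \<Longrightarrow> x0 i \<in> rdom i" and "0 \<le> W"
proof -
  have x0: "x0 i \<in> Rn n" "(norm (x0 i - xs i))\<^sup>2 \<le> W" if "i \<in> V" for i
    using assms that by (auto simp: initial_bound_def)
  have l0: "(norm (l0 i j - ls i j))\<^sup>2 \<le> W" if "i \<in> V" "j \<in> nbrs P i" for i j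
    using assms that by (auto simp: initial_bound_def)
  show W: "0 \<le> W"
    using x0(2) nodes_nonempty by (meson all_not_in_conv order_trans zero_le_power2)
  \<comment> \<open>A finite upper bound on the extended Bregman divergence excludes the value
    \<open>\<infinity>\<close> of the regularizer.\<close>
  show "x0 i \<in> rdom i" if i: "i \<in> V"
  proof -
    obtain b where "reg P i (xs i) = ereal b"
      using effective_domainD(2) [OF xs_in_dom [OF i]] by blast
    moreover have "reg P i (x0 i) \<noteq> - \<infinity>"
      using reg_closed_convex [OF i] x0(1) [OF i] by (auto simp: proper_closed_convex_def)
    moreover have "bregman_total P i (vs i) (x0 i) (xs i) \<le> ereal W"
      using assms i by (auto simp: initial_bound_def)
    ultimately show ?thesis
      using x0(1) [OF i] by (cases "reg P i (x0 i)")
        (auto simp: bregman_total_def bregman_sub_def effective_domain_def)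
  qed
  have primal: "(\<Sum>i\<in>V. 3 * L * (norm (x0 i - xs i))\<^sup>2) \<le> real (card V) * (3 * L * W)"
    using x0(2) L_pos by (intro sum_bounded_above) (auto intro: mult_left_mono)
  have loss: "(\<Sum>i\<in>V. 2 / 5 * loss_gap i (x0 i)) \<le> real (card V) * (L * W)"
  proof (intro sum_bounded_above)
    fix i assume i: "i \<in> V"
    \<comment> \<open>The bound through the squared distance keeps a factor \<open>L\<close>, unlike
      the direct bound \<open>W\<close> on the divergence.\<close>
    have "loss_gap i (x0 i) \<le> L / 2 * (norm (x0 i - xs i))\<^sup>2"
      using i x0 by (intro loss_gap_le) auto
    also have "\<dots> \<le> L / 2 * W"
      using i x0 L_pos by (intro mult_left_mono) auto
    finally show "2 / 5 * loss_gap i (x0 i) \<le> L * W"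
      using mult_nonneg_nonneg [of L W] L_pos W by linarith
  qed
  have "(\<Sum>(i, j)\<in>arcs P. (norm (\<rho> *\<^sub>R (x0 i - xs i) - (l0 i j - ls i j)))\<^sup>2)
      \<le> real (card (arcs P)) * (2 * (\<rho>\<^sup>2 * W + W))"
  proof (intro sum_bounded_above)
    fix p assume "p \<in> arcs P"
    then obtain i j where p: "p = (i, j)" "i \<in> V" "j \<in> nbrs P i"
      by (auto simp: arcs_def)
    from power2_norm_diff_le [of "\<rho> *\<^sub>R (x0 i - xs i)" "l0 i j - ls i j"]
    have "(norm (\<rho> *\<^sub>R (x0 i - xs i) - (l0 i j - ls i j)))\<^sup>2
        \<le> 2 * (\<rho>\<^sup>2 * (norm (x0 i - xs i))\<^sup>2 + (norm (l0 i j - ls i j))\<^sup>2)"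
      by (simp add: power_mult_distrib)
    also have "\<dots> \<le> 2 * (\<rho>\<^sup>2 * W + W)"
      using x0(2) l0 p by (intro mult_left_mono add_mono) auto
    finally show "(case p of (i, j) \<Rightarrow> (norm (\<rho> *\<^sub>R (x0 i - xs i) - (l0 i j - ls i j)))\<^sup>2)
        \<le> 2 * (\<rho>\<^sup>2 * W + W)"
      by (simp add: p)
  qed
  also have "\<dots> \<le> real (2 * card (edges P)) * (2 * (\<rho>\<^sup>2 * W + W))"
    using card_arcs_le W by (intro mult_right_mono) auto
  finally have "dual_potential x0 l0 \<le> real (2 * card (edges P)) * (2 * (\<rho>\<^sup>2 * W + W)) / (4 * \<rho>)"
    unfolding dual_potential_def using \<rho>_pos by (intro divide_right_mono) auto
  \<comment> \<open>Two orientations per edge and the factor 2 of the norm inequality cancel the 4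
    in \<open>dual_potential\<close>.\<close>
  also have "\<dots> = real (card (edges P)) * ((\<rho> + 1 / \<rho>) * W)"
    using \<rho>_pos by (simp add: field_simps power2_eq_square)
  finally have dual: "dual_potential x0 l0 \<le> real (card (edges P)) * ((\<rho> + 1 / \<rho>) * W)" .
  have "potential x0 l0 + real M * (\<Sum>i\<in>V. 2 / 5 * loss_gap i (x0 i))
      \<le> real (card V) * (3 * L * W) + real (card (edges P)) * ((\<rho> + 1 / \<rho>) * W)
        + real M * (real (card V) * (L * W))"
    unfolding potential_def using primal dual mult_left_mono [OF loss, of "real M"] by simp
  also have "\<dots> = (3 + real M) * W * (real (card V) * L) + (\<rho> + 1 / \<rho>) * W * real (card (edges P))"
    by (simp add: algebra_simps)
  also have "\<dots> \<le> (3 + \<rho> + 1 / \<rho> + real M) * W * (real (card V) * L)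
      + (3 + \<rho> + 1 / \<rho> + real M) * W * real (card (edges P))"
  proof (rule add_mono)
    have "3 + real M \<le> 3 + \<rho> + 1 / \<rho> + real M" "\<rho> + 1 / \<rho> \<le> 3 + \<rho> + 1 / \<rho> + real M"
      using \<rho>_pos by auto
    then show "(3 + real M) * W * (real (card V) * L)
        \<le> (3 + \<rho> + 1 / \<rho> + real M) * W * (real (card V) * L)"
      and "(\<rho> + 1 / \<rho>) * W * real (card (edges P))
        \<le> (3 + \<rho> + 1 / \<rho> + real M) * W * real (card (edges P))"
      using W L_pos by (meson mult_right_mono mult_nonneg_nonneg of_nat_0_le_iff less_imp_le)+
  qed
  also have "\<dots> = (3 + \<rho> + 1 / \<rho> + real M) * W * (real (card (edges P)) + real (card V) * L)"
    by (simp add: algebra_simps)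
  finally show "potential x0 l0 + real M * (\<Sum>i\<in>V. 2 / 5 * loss_gap i (x0 i))
    \<le> (3 + \<rho> + 1 / \<rho> + real M) * W * (real (card (edges P)) + real (card V) * L)" .
qed

end

section \<open>Counting epochs\<close>

text \<open>The least \<open>s\<close> with \<open>c * R \<le> 2 ^ s\<close> overshoots by at most a
  factor 2. Taking logarithms bounds it, and \<open>R \<ge> 2\<close> lets \<open>ln R\<close>
  absorb the additive constants, so \<open>C\<close> depends on \<open>c\<close> alone.\<close>

lemma dyadic_epoch_count:
  fixes c :: real
  assumes c: "c \<ge> 1"
  shows "\<exists>C>0. \<forall>R\<ge>2. \<exists>s. c * R \<le> 2 ^ s \<and> 2 ^ s \<le> 2 * c * R \<and> real (Suc s) \<le> C * ln R"
proof -
  let ?C = "(2 + ln (2 * c) / ln 2) / ln 2"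
  have ln2c: "0 \<le> ln (2 * c)" using c by simp
  then have C: "0 < ?C" by (intro divide_pos_pos add_pos_nonneg) auto
  have "\<exists>s. c * R \<le> 2 ^ s \<and> 2 ^ s \<le> 2 * c * R \<and> real (Suc s) \<le> ?C * ln R"
    if R: "R \<ge> 2" for R :: real
  proof -
  define s where "s = (LEAST s. c * R \<le> 2 ^ s)"
  have "\<exists>s. c * R \<le> 2 ^ s"
    using real_arch_pow [of 2 "c * R"] by (auto intro: less_imp_le)
  then have le: "c * R \<le> 2 ^ s"
    unfolding s_def by (rule LeastI_ex)
  \<comment> \<open>Excludes \<open>s = 0\<close>, so that minimality can be applied to the
    predecessor of \<open>s\<close>.\<close>
  have "c * R \<ge> 2"
    using mult_mono [of 1 c 2 R] c R by simp
  with le have "s \<noteq> 0" by (intro notI) simp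
  then obtain r where r: "s = Suc r" by (cases s) auto
  then have "\<not> c * R \<le> 2 ^ r"
    using not_less_Least [of r "\<lambda>s. c * R \<le> 2 ^ s"] by (simp add: s_def)
  then have upper: "2 ^ s \<le> 2 * c * R"
    by (simp add: r)
  have "real s * ln 2 = ln (2 ^ s)"
    by (simp add: ln_realpow)
  also have "\<dots> \<le> ln (2 * c * R)"
    using upper c R by (subst ln_le_cancel_iff) auto
  also have "\<dots> = ln (2 * c) + ln R"
    using c R by (subst ln_mult) auto
  finally have "real s * ln 2 \<le> ln (2 * c) + ln R" .
  moreover have ln2: "ln 2 \<le> ln R"
    using R by simp
  moreover have "ln (2 * c) \<le> ln (2 * c) / ln 2 * ln R"
    using mult_left_mono [OF ln2 ln2c] by (simp add: field_simps)
  ultimately have "real (Suc s) * ln 2 \<le> (2 + ln (2 * c) / ln 2) * ln R"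
    by (simp add: algebra_simps)
  then have "real (Suc s) \<le> ?C * ln R"
    by (simp add: field_simps)
  with le upper show ?thesis
    by blast
  qed
  with C show ?thesis by blast
qed

text \<open>A geometric sum, in additive form to avoid subtraction of natural numbers.\<close>

lemma sum_doubling:
  assumes "\<And>s. m (Suc s) = 2 ^ s * a"
  shows "(\<Sum>s = 1..Suc r. m s) + a = 2 * (2 ^ r * (a :: nat))"
  by (induction r) (use assms assms [of 0] in auto)

section \<open>From the divergence bound to oracle calls and communication rounds\<close>

theorem lemma3p3:
  fixes \<rho> W\<^sub>1 :: real and m\<^sub>1 :: nat
  assumes "\<rho> > 0" and "m\<^sub>1 \<ge> 1"
  shows "\<exists>C>0. \<forall>P K L m x0 l0 xs ls vs \<epsilon>.
    valid_problem P \<and>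
    (\<forall>i\<in>nodes P. ncomp P i = K) \<and> (\<forall>i\<in>nodes P. smoothness P i = L) \<and>
    m 1 = m\<^sub>1 \<and> (\<forall>s\<ge>1. m (s + 1) = 2 ^ s * m\<^sub>1) \<and>
    optimal_triple P xs ls vs \<and>
    initial_bound P xs ls vs x0 l0 W\<^sub>1 \<and>
    \<epsilon> > 0 \<longrightarrow>
    (let R = (real (card (edges P)) + real (card (nodes P)) * L) / \<epsilon>;
         \<eta> = (\<lambda>i. 1 / (6 * L))
     in R \<ge> 2 \<longrightarrow>
        ereal_of_enat (oracle_complexity P \<rho> \<eta> m K x0 l0 xs vs \<epsilon>) \<le>
          ereal (C * (R + real K * ln R)) \<and>
        ereal_of_enat (communication_complexity P \<rho> \<eta> m x0 l0 xs vs \<epsilon>) \<le>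
          ereal (C * R))"
proof -
  \<comment> \<open>The constant of \<open>initial_potential_le\<close> for
    \<open>M = m\<^sub>1\<close>. The absolute value keeps it nonnegative before an instance shows
    \<open>0 \<le> W\<^sub>1\<close>; the added 1 ensures \<open>c \<ge> 1\<close>.\<close>
  define c where "c = (3 + \<rho> + 1 / \<rho> + real m\<^sub>1) * \<bar>W\<^sub>1\<bar> + 1"
  have c: "c \<ge> 1"
    unfolding c_def using assms by simp
  from dyadic_epoch_count [OF c] obtain C1 where C1: "C1 > 0"
    and epochs: "\<And>R. R \<ge> 2 \<Longrightarrow>
      \<exists>s. c * R \<le> 2 ^ s \<and> 2 ^ s \<le> 2 * c * R \<and> real (Suc s) \<le> C1 * ln R"
    by blast
  \<comment> \<open>The first summand pays for two gradients per inner iteration, the second for the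
    full gradients of all epochs.\<close>
  define C where "C = 8 * c * real m\<^sub>1 + C1"
  have C: "C > 0"
    unfolding C_def using c C1 by (intro add_nonneg_pos mult_nonneg_nonneg) auto
  have "ereal_of_enat (oracle_complexity P \<rho> \<eta> m K x0 l0 xs vs \<epsilon>) \<le> ereal (C * (R + real K * ln R))
      \<and> ereal_of_enat (communication_complexity P \<rho> \<eta> m x0 l0 xs vs \<epsilon>) \<le> ereal (C * R)"
    if P: "valid_problem P" "\<forall>i\<in>nodes P. ncomp P i = K" "\<forall>i\<in>nodes P. smoothness P i = L"
      "optimal_triple P xs ls vs"
      and m1: "m 1 = m\<^sub>1" and m2: "\<forall>s\<ge>1. m (s + 1) = 2 ^ s * m\<^sub>1"
      and init: "initial_bound P xs ls vs x0 l0 W\<^sub>1" and \<epsilon>: "\<epsilon> > 0"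
      and R_def: "R = (real (card (edges P)) + real (card (nodes P)) * L) / \<epsilon>" and R: "R \<ge> 2"
      and \<eta>: "\<eta> = (\<lambda>i. 1 / (6 * L))"
    for P K L m x0 l0 xs ls vs \<epsilon> R \<eta>
  proof -
    interpret decentralized_optimum P K L \<rho> xs ls vs
      using P assms(1) by unfold_locales auto
    \<comment> \<open>The two conditions on \<open>m\<close> merge into one formula shifted by one:
      the last of \<open>Suc s\<close> epochs has length \<open>2 ^ s * m\<^sub>1\<close>.\<close>
    have m: "m (Suc s) = 2 ^ s * m\<^sub>1" for s
      using m1 m2 by (cases s) auto
    have m_Suc: "m s \<ge> 1 \<and> m (Suc s) \<le> 2 * m s" if "s \<ge> 1" for s
      using that assms(2) by (cases s) (simp_all add: m Suc_le_eq)
    then have m_pos: "\<forall>s\<ge>1. m s \<ge> 1" and m_double: "\<forall>s\<ge>1. m (Suc s) \<le> 2 * m s"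
      by blast+
    obtain s where s: "c * R \<le> 2 ^ s" "2 ^ s \<le> 2 * c * R" "real (Suc s) \<le> C1 * ln R"
      using epochs [OF R] by blast
    let ?B = "potential x0 l0 + real (m 1) * (\<Sum>i\<in>nodes P. 2 / 5 * loss_gap i (x0 i))"
    have "?B \<le> (3 + \<rho> + 1 / \<rho> + real m\<^sub>1) * W\<^sub>1 * (R * \<epsilon>)"
      using initial_potential_le(1) [OF init, of "m 1"] \<epsilon> unfolding R_def m1 by simp
    also have "\<dots> \<le> c * (R * \<epsilon>)"
      using R \<epsilon> initial_potential_le(3) [OF init] by (intro mult_right_mono) (auto simp: c_def)
    also have "\<dots> \<le> 2 ^ s * \<epsilon>"
      using s(1) \<epsilon> by simp
    also have "\<dots> \<le> real (m (Suc s)) * \<epsilon>"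
      using \<epsilon> assms(2) by (simp add: m)
    finally have "?B / real (m (Suc s)) \<le> \<epsilon>"
      using spec [OF m_pos, of "Suc s"] by (simp add: pos_divide_le_eq mult.commute)
    then have "expected_divergence P \<rho> \<eta> m x0 l0 xs vs (Suc s) \<le> ennreal \<epsilon>"
      using expected_divergence_le [OF _ m_pos m_double, of x0 l0 s]
        initial_potential_le(2) [OF init] ennreal_leI order_trans unfolding \<eta> by blast
    then have suff: "Suc s \<in> sufficient_epochs P \<rho> \<eta> m x0 l0 xs vs \<epsilon>"
      by (simp add: sufficient_epochs_def)
    have "(\<Sum>s = 1..Suc s. m s) \<le> 2 * (2 ^ s * m\<^sub>1)"
      using sum_doubling [of m m\<^sub>1 s, OF m] by linarith
    then have "real (\<Sum>s = 1..Suc s. m s) \<le> 2 * 2 ^ s * real m\<^sub>1"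
      by (metis (no_types, lifting) mult.assoc of_nat_le_iff of_nat_mult of_nat_numeral of_nat_power)
    also have "\<dots> \<le> 2 * (2 * c * R) * real m\<^sub>1"
      using s(2) by (intro mult_right_mono mult_left_mono) auto
    finally have total: "real (\<Sum>s = 1..Suc s. m s) \<le> 4 * c * real m\<^sub>1 * R"
      by (simp add: mult_ac)
    have lnR: "0 \<le> ln R" using R by simp
    \<comment> \<open>The complexity is an infimum, so the single sufficient number
      \<open>Suc s\<close> of epochs bounds it.\<close>
    have "communication_complexity P \<rho> \<eta> m x0 l0 xs vs \<epsilon> \<le> enat (\<Sum>s = 1..Suc s. m s)"
      unfolding communication_complexity_def by (rule INF_lower [OF suff])
    then have "ereal_of_enat (communication_complexity P \<rho> \<eta> m x0 l0 xs vs \<epsilon>)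
        \<le> ereal (real (\<Sum>s = 1..Suc s. m s))"
      by (metis ereal_of_enat_le_iff ereal_of_enat_simps(1))
    also have "\<dots> \<le> ereal (C * R)"
    proof -
      have "4 * c * real m\<^sub>1 * R \<le> C * R"
        using C1 c R unfolding C_def by (intro mult_right_mono) auto
      with total show ?thesis by simp
    qed
    finally have comm: "ereal_of_enat (communication_complexity P \<rho> \<eta> m x0 l0 xs vs \<epsilon>) \<le> ereal (C * R)" .
    have "oracle_complexity P \<rho> \<eta> m K x0 l0 xs vs \<epsilon> \<le> enat (\<Sum>s = 1..Suc s. K + 2 * m s)"
      unfolding oracle_complexity_def by (rule INF_lower [OF suff])
    then have "ereal_of_enat (oracle_complexity P \<rho> \<eta> m K x0 l0 xs vs \<epsilon>)
        \<le> ereal (real (\<Sum>s = 1..Suc s. K + 2 * m s))"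
      by (metis ereal_of_enat_le_iff ereal_of_enat_simps(1))
    also have "real (\<Sum>s = 1..Suc s. K + 2 * m s) = real K * real (Suc s) + 2 * real (\<Sum>s = 1..Suc s. m s)"
      by (simp add: sum.distrib sum_distrib_left algebra_simps del: sum.cl_ivl_Suc)
    also have "ereal \<dots> \<le> ereal (C * (R + real K * ln R))"
    proof -
      have "real K * real (Suc s) \<le> real K * (C1 * ln R)"
        using s(3) by (intro mult_left_mono) auto
      also have "\<dots> \<le> C * (real K * ln R)"
        using lnR c unfolding C_def by (simp add: algebra_simps)
      finally have "real K * real (Suc s) \<le> C * (real K * ln R)" .
      moreover have "8 * c * real m\<^sub>1 * R \<le> C * R"
        using C1 R unfolding C_def by (intro mult_right_mono) auto
      ultimately show ?thesis
        using total by (simp add: distrib_left del: sum.cl_ivl_Suc)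
    qed
    finally show ?thesis using comm by blast
  qed
  with C show ?thesis
    unfolding Let_def by (intro exI [of _ C]) blast
qed

end
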